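(* In the random environment model described in the context, under the standing assumptions, including measurability of $\mathcal{C}$ with respect to the product $\sigma$-algebra on $S^{\mathbb{Z}}$, one has, for $y\in S^{\mathbb{Z}}$, $$\frac1n\sum_{0\le p<n}\mathrm{Cov}^y_{p,\eta^y_{p-1}}\left(\overline{Q}^y_{p,n}(1),\overline{Q}^y_{p,n}(1)\right)=\frac1n\sum_{1\le p<n}\mathcal{C}(\theta^p(y))+\mathrm{O}(1/n).$$ In addition, almost surely, $$\lim_{n\to\infty}\frac1n\sum_{0\le p<n}\mathrm{Cov}^Y_{p,\eta^Y_{p-1}}\left(\overline{Q}^Y_{p,n}(1),\overline{Q}^Y_{p,n}(1)\right)=\mathbb{E}\left(\mathrm{Cov}^{\theta^{-1}(Y)}_{1,\eta_\infty^{\theta^{-1}(Y)}}(h^Y,h^Y)\right).$$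
   Context: Random environment model. $E$ is a Polish space; $(S,\mathcal{S})$ is a measurable space; $Y=(Y_n)_{n\in\mathbb{Z}}$ is a stationary ergodic $S$-valued process; $\eta_0$ is a probability measure on $E$ (initial law). $(M_s)_{s\in S}$ are Markov kernels on $E$ and $(G_s)_{s\in S}$ are positive bounded measurable functions on $E$. Write $\mu(f)=\int f\,d\mu$, $\mu K(dx')=\int\mu(dx)K(x,dx')$, $K(f)(x)=\int f(x')K(x,dx')$, $\|f\|=\sup_x|f(x)|$, $\mathrm{osc}(f)=\sup_{x,y}|f(x)-f(y)|$, $\mathrm{Osc}(E)=\{f \text{ measurable}:\mathrm{osc}(f)\le1\}$, $\Psi_G(\mu)(dx)=\frac1{\mu(G)}G(x)\mu(dx)$. A family of Markov kernels $K_{(s,s'),\mu}$ ($s,s'\in S$, $\mu$ a probability measure on $E$) is given with $\Psi_{G_s}(\mu)M_{s'}=\mu K_{(s,s'),\mu}$. For $y\in S^{\mathbb{Z}}$ put $M^y_n=M_{y_n}$, $G^y_n=G_{y_n}$, $K^y_{n,\mu}=K_{(y_{n-1},y_n),\mu}$ ($n\ge1$), $K^y_{0,\mu}(x,\cdot)=\eta_0$, $\Phi^y_n(\mu)=\Psi_{G^y_{n-1}}(\mu)M^y_n$, $\Phi^y_{p,n}=\Phi^y_n\circ\cdots\circ\Phi^y_{p+1}$, $\eta^y_0=\eta^y_{-1}=\eta_0$, $\eta^y_n=\Phi^y_{0,n}(\eta_0)$. For $0\le p\le n$, $Q^y_{p,n}(f)(x)=\mathbb{E}\big(f(X_n)\prod_{p\le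 q<n}G^y_q(X_q)\,\big|\,X_p=x\big)$, where $(X_n)$ is the Markov chain with kernels $(M^y_n)_{n\ge1}$; $\overline{Q}^y_{p,n}(f)=Q^y_{p,n}(f)/\eta^y_p(Q^y_{p,n}(1))$; $P^y_{p,n}(f)=Q^y_{p,n}(f)/Q^y_{p,n}(1)$. $\mathrm{Cov}^y_{n,\mu}(f_1,f_2)=\mu\big[K^y_{n,\mu}(f_1f_2)-K^y_{n,\mu}(f_1)K^y_{n,\mu}(f_2)\big]$. The shift is $\theta(y)=(y_{n+1})_{n\in\mathbb{Z}}$. The Dobrushin coefficient is $\beta(P)=\sup_{x,x'\in E,\,f\in\mathrm{Osc}(E)}|P(f)(x)-P(f)(x')|$. Standing assumptions, uniform over $y\in S^{\mathbb{Z}}$: (i) $\sup G^y_n/\inf G^y_n\le g$ for a finite $g$; (ii) $\beta(P^y_{p,n})\le a\,e^{-\lambda(n-p)}$ for all $0\le p\le n$, with finite $a$ and $\lambda>0$; (iii) for a finite $\kappa$, for all $n\ge1$, all probability measures $\mu_1,\mu_2$ and $f\in\mathrm{Osc}(E)$, $\|[K^y_{n,\mu_1}-K^y_{n,\mu_2}](f)\|\le\kappa|(\mu_1-\mu_2)(T^y_n(f,\mu_2))|$ with $T^y_n(f,\mu_2)\in\mathrm{Osc}(E)$ not depending on $\mu_1$. Under these assumptions, for every $y$ and every probability measure $\mu$, $\Phi_{0,n}^{\theta^{-n}(y)}(\mu)$ converges weakly as $n\to\infty$ to a probability measure $\eta^y_\infty$ not depending on $\mu$. The function $h^y$ is defined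 by $\log h^y(x)=\sum_{q\ge0}\left[\log\Phi^y_{0,q}(\delta_x)(G^y_q)-\log\Phi^y_{0,q}(\eta^y_\infty)(G^y_q)\right]$, and $\mathcal{C}(y):=\mathrm{Cov}^{\theta^{-1}(y)}_{1,\eta_\infty^{\theta^{-1}(y)}}(h^y,h^y)$ for $y\in S^{\mathbb{Z}}$. *)

theory Defs
  imports "HOL-Probability.Probability"
begin

text \<open>
  Environments are functions \<open>y :: int \<Rightarrow> 's\<close>; the set of environments and its product
  sigma-algebra are \<open>env_space S\<close>.  Probability measures on the Polish space are the elements of
  \<open>space (prob_algebra borel)\<close>, Markov kernels the elements of
  \<open>borel \<rightarrow>\<^sub>M prob_algebra borel\<close>, and \<open>\<mu> K\<close> is \<open>\<mu> \<bind> K\<close>.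
\<close>

abbreviation env_space :: "'s measure \<Rightarrow> (int \<Rightarrow> 's) measure" where
  "env_space S \<equiv> PiM UNIV (\<lambda>_. S)"

(* The k-th power of the shift; k may be negative. *)
definition env_shift :: "int \<Rightarrow> (int \<Rightarrow> 's) \<Rightarrow> int \<Rightarrow> 's" where
  "env_shift k y = (\<lambda>n. y (n + k))"

definition trajectory :: "(int \<Rightarrow> 'w \<Rightarrow> 's) \<Rightarrow> 'w \<Rightarrow> int \<Rightarrow> 's" where
  "trajectory Y \<omega> = (\<lambda>n. Y n \<omega>)"

definition stationary_process :: "'w measure \<Rightarrow> 's measure \<Rightarrow> (int \<Rightarrow> 'w \<Rightarrow> 's) \<Rightarrow> bool" where
  "stationary_process P S Y \<longleftrightarrow>
     (\<forall>n. Y n \<in> P \<rightarrow>\<^sub>M S) \<and>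
     distr P (env_space S) (\<lambda>\<omega>. env_shift 1 (trajectory Y \<omega>)) = distr P (env_space S) (trajectory Y)"

definition ergodic_process :: "'w measure \<Rightarrow> 's measure \<Rightarrow> (int \<Rightarrow> 'w \<Rightarrow> 's) \<Rightarrow> bool" where
  "ergodic_process P S Y \<longleftrightarrow>
     (\<forall>A\<in>sets (env_space S). env_shift 1 -` A \<inter> space (env_space S) = A \<longrightarrow>
        measure (distr P (env_space S) (trajectory Y)) A \<in> {0, 1})"

text \<open>Suprema are taken in \<open>ereal\<close>, since \<open>Sup\<close> on \<open>real\<close> is unspecified on unbounded sets.\<close>

definition sup_norm :: "('e \<Rightarrow> real) \<Rightarrow> ereal" where
  "sup_norm f = (SUP x. ereal \<bar>f x\<bar>)"

definition osc :: "('e \<Rightarrow> real) \<Rightarrow> ereal" where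
  "osc f = (SUP x. SUP y. ereal \<bar>f x - f y\<bar>)"

definition Osc :: "('e::topological_space \<Rightarrow> real) set" where
  "Osc = {f \<in> borel_measurable borel. osc f \<le> 1}"

definition dobrushin :: "(('e::topological_space \<Rightarrow> real) \<Rightarrow> 'e \<Rightarrow> real) \<Rightarrow> ereal" where
  "dobrushin P = (SUP x. SUP x'. SUP f\<in>Osc. ereal \<bar>P f x - P f x'\<bar>)"

definition kernel_op :: "('e \<Rightarrow> 'e measure) \<Rightarrow> ('e \<Rightarrow> real) \<Rightarrow> 'e \<Rightarrow> real" where
  "kernel_op K f x = (\<integral>x'. f x' \<partial>K x)"

(* The Boltzmann-Gibbs transformation. *)
definition Psi :: "('e \<Rightarrow> real) \<Rightarrow> 'e measure \<Rightarrow> 'e measure" where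
  "Psi G \<mu> = density \<mu> (\<lambda>x. ennreal (G x / (\<integral>z. G z \<partial>\<mu>)))"

definition M_at :: "('s \<Rightarrow> 'e \<Rightarrow> 'e measure) \<Rightarrow> (int \<Rightarrow> 's) \<Rightarrow> nat \<Rightarrow> 'e \<Rightarrow> 'e measure" where
  "M_at M y n = M (y (int n))"

definition G_at :: "('s \<Rightarrow> 'e \<Rightarrow> real) \<Rightarrow> (int \<Rightarrow> 's) \<Rightarrow> nat \<Rightarrow> 'e \<Rightarrow> real" where
  "G_at G y n = G (y (int n))"

definition K_at :: "('s \<times> 's \<Rightarrow> 'e measure \<Rightarrow> 'e \<Rightarrow> 'e measure) \<Rightarrow> 'e measure \<Rightarrow>
    (int \<Rightarrow> 's) \<Rightarrow> nat \<Rightarrow> 'e measure \<Rightarrow> 'e \<Rightarrow> 'e measure" where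
  "K_at K \<eta>\<^sub>0 y n \<mu> =
     (if n = 0 then (\<lambda>x. \<eta>\<^sub>0) else K (y (int n - 1), y (int n)) \<mu>)"

(* One-step flow; only used for n \<ge> 1, where n - 1 on nat is the usual subtraction. *)
definition Phi_step :: "('s \<Rightarrow> 'e \<Rightarrow> 'e measure) \<Rightarrow> ('s \<Rightarrow> 'e \<Rightarrow> real) \<Rightarrow>
    (int \<Rightarrow> 's) \<Rightarrow> nat \<Rightarrow> 'e measure \<Rightarrow> 'e measure" where
  "Phi_step M G y n \<mu> = Psi (G_at G y (n - 1)) \<mu> \<bind> M_at M y n"

(* Phi M G y p n applies the steps p + 1, ..., n in this order; it is the identity if p = n. *)
definition Phi :: "('s \<Rightarrow> 'e \<Rightarrow> 'e measure) \<Rightarrow> ('s \<Rightarrow> 'e \<Rightarrow> real) \<Rightarrow>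
    (int \<Rightarrow> 's) \<Rightarrow> nat \<Rightarrow> nat \<Rightarrow> 'e measure \<Rightarrow> 'e measure" where
  "Phi M G y p n = fold (Phi_step M G y) [Suc p..<Suc n]"

(* Integer time, because the index -1 is needed. *)
definition eta :: "('s \<Rightarrow> 'e \<Rightarrow> 'e measure) \<Rightarrow> ('s \<Rightarrow> 'e \<Rightarrow> real) \<Rightarrow> 'e measure \<Rightarrow>
    (int \<Rightarrow> 's) \<Rightarrow> int \<Rightarrow> 'e measure" where
  "eta M G \<eta>\<^sub>0 y k = (if k < 0 then \<eta>\<^sub>0 else Phi M G y 0 (nat k) \<eta>\<^sub>0)"

text \<open>
  The law of \<open>(X\<^sub>p, \<dots>, X\<^sub>p\<^sub>+\<^sub>m)\<close> under \<open>X\<^sub>p = x\<close>, where \<open>X\<close> is the Markov chain with kernels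
  \<open>M_at M y n\<close>.  The coordinate \<open>i\<close> of a path is \<open>X\<^sub>p\<^sub>+\<^sub>i\<close>.
\<close>

definition chain_law :: "('s \<Rightarrow> 'e::topological_space \<Rightarrow> 'e measure) \<Rightarrow> (int \<Rightarrow> 's) \<Rightarrow>
    nat \<Rightarrow> 'e \<Rightarrow> nat \<Rightarrow> (nat \<Rightarrow> 'e) measure" where
  "chain_law M y p x m =
     Ionescu_Tulcea.C
       (\<lambda>i \<omega>. case i of 0 \<Rightarrow> return borel x | Suc j \<Rightarrow> M_at M y (p + i) (\<omega> j))
       (\<lambda>_. borel) 0 (Suc m) (\<lambda>_. undefined)"

definition Q_op :: "('s \<Rightarrow> 'e::topological_space \<Rightarrow> 'e measure) \<Rightarrow> ('s \<Rightarrow> 'e \<Rightarrow> real) \<Rightarrow>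
    (int \<Rightarrow> 's) \<Rightarrow> nat \<Rightarrow> nat \<Rightarrow> ('e \<Rightarrow> real) \<Rightarrow> 'e \<Rightarrow> real" where
  "Q_op M G y p n f x =
     (\<integral>X. f (X (n - p)) * (\<Prod>q\<in>{p..<n}. G_at G y q (X (q - p))) \<partial>chain_law M y p x (n - p))"

definition Q_bar :: "('s \<Rightarrow> 'e::topological_space \<Rightarrow> 'e measure) \<Rightarrow> ('s \<Rightarrow> 'e \<Rightarrow> real) \<Rightarrow>
    'e measure \<Rightarrow> (int \<Rightarrow> 's) \<Rightarrow> nat \<Rightarrow> nat \<Rightarrow> ('e \<Rightarrow> real) \<Rightarrow> 'e \<Rightarrow> real" where
  "Q_bar M G \<eta>\<^sub>0 y p n f x =
     Q_op M G y p n f x / (\<integral>z. Q_op M G y p n (\<lambda>_. 1) z \<partial>eta M G \<eta>\<^sub>0 y (int p))"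

definition P_op :: "('s \<Rightarrow> 'e::topological_space \<Rightarrow> 'e measure) \<Rightarrow> ('s \<Rightarrow> 'e \<Rightarrow> real) \<Rightarrow>
    (int \<Rightarrow> 's) \<Rightarrow> nat \<Rightarrow> nat \<Rightarrow> ('e \<Rightarrow> real) \<Rightarrow> 'e \<Rightarrow> real" where
  "P_op M G y p n f x = Q_op M G y p n f x / Q_op M G y p n (\<lambda>_. 1) x"

definition Cov :: "('s \<times> 's \<Rightarrow> 'e measure \<Rightarrow> 'e \<Rightarrow> 'e measure) \<Rightarrow> 'e measure \<Rightarrow>
    (int \<Rightarrow> 's) \<Rightarrow> nat \<Rightarrow> 'e measure \<Rightarrow> ('e \<Rightarrow> real) \<Rightarrow> ('e \<Rightarrow> real) \<Rightarrow> real" where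
  "Cov K \<eta>\<^sub>0 y n \<mu> f\<^sub>1 f\<^sub>2 =
     (\<integral>x. kernel_op (K_at K \<eta>\<^sub>0 y n \<mu>) (\<lambda>x'. f\<^sub>1 x' * f\<^sub>2 x') x
          - kernel_op (K_at K \<eta>\<^sub>0 y n \<mu>) f\<^sub>1 x * kernel_op (K_at K \<eta>\<^sub>0 y n \<mu>) f\<^sub>2 x \<partial>\<mu>)"

(* The library's weak_conv_m covers measures on real only. *)
definition weakly_converges :: "(nat \<Rightarrow> 'e::topological_space measure) \<Rightarrow> 'e measure \<Rightarrow> bool" where
  "weakly_converges \<mu> \<nu> \<longleftrightarrow>
     (\<forall>f :: 'e \<Rightarrow> real. continuous_on UNIV f \<and> bounded (range f) \<longrightarrow>
        (\<lambda>n. \<integral>x. f x \<partial>\<mu> n) \<longlonglongrightarrow> (\<integral>x. f x \<partial>\<nu>))"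

definition eta_inf :: "('s \<Rightarrow> 'e::topological_space \<Rightarrow> 'e measure) \<Rightarrow> ('s \<Rightarrow> 'e \<Rightarrow> real) \<Rightarrow>
    (int \<Rightarrow> 's) \<Rightarrow> 'e measure" where
  "eta_inf M G y =
     (THE \<nu>. \<nu> \<in> space (prob_algebra borel) \<and>
        (\<forall>\<mu>\<in>space (prob_algebra borel).
           weakly_converges (\<lambda>n. Phi M G (env_shift (- int n) y) 0 n \<mu>) \<nu>))"

definition h_fun :: "('s \<Rightarrow> 'e::topological_space \<Rightarrow> 'e measure) \<Rightarrow> ('s \<Rightarrow> 'e \<Rightarrow> real) \<Rightarrow>
    (int \<Rightarrow> 's) \<Rightarrow> 'e \<Rightarrow> real" where
  "h_fun M G y x = exp (\<Sum>q.
       ln (\<integral>z. G_at G y q z \<partial>Phi M G y 0 q (return borel x))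
     - ln (\<integral>z. G_at G y q z \<partial>Phi M G y 0 q (eta_inf M G y)))"

definition C_fun :: "('s \<Rightarrow> 'e::topological_space \<Rightarrow> 'e measure) \<Rightarrow> ('s \<Rightarrow> 'e \<Rightarrow> real) \<Rightarrow>
    ('s \<times> 's \<Rightarrow> 'e measure \<Rightarrow> 'e \<Rightarrow> 'e measure) \<Rightarrow> 'e measure \<Rightarrow> (int \<Rightarrow> 's) \<Rightarrow> real" where
  "C_fun M G K \<eta>\<^sub>0 y =
     Cov K \<eta>\<^sub>0 (env_shift (- 1) y) 1 (eta_inf M G (env_shift (- 1) y)) (h_fun M G y) (h_fun M G y)"

end

theory Submission
  imports Defs
begin

text \<open>
  Since \<open>\<Phi>\<^sub>p\<^sub>,\<^sub>n(\<mu>)\<close> averages \<open>P\<^sub>p\<^sub>,\<^sub>n\<close> under a tilted measure, the flow forgets its starting point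
  at rate \<open>a r ^ (n - p)\<close> with \<open>r = exp (- \<lambda>)\<close>, uniformly over the environment; this gives the
  limit \<open>\<eta>\<^sub>\<infinity>\<close> and \<open>\<Phi>\<^sub>0\<^sub>,\<^sub>n(\<eta>\<^sub>\<infinity>\<^sup>y) = \<eta>\<^sub>\<infinity>\<close> at the shifted environment.  Telescoping,
  \<open>ln Q\<^sub>p\<^sub>,\<^sub>n(1)(x) = \<Sum>\<^sub>p\<^sub>\<le>\<^sub>q\<^sub><\<^sub>n ln \<Phi>\<^sub>p\<^sub>,\<^sub>q(\<delta>\<^sub>x)(G\<^sub>q)\<close>, so the normalised \<open>Q\<^sub>p\<^sub>,\<^sub>n(1)\<close> differs from \<open>h\<close> at
  the shifted environment by \<open>O(r ^ p + r ^ (n - p))\<close> in sup norm.  The covariance functional is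
  Lipschitz in the measure and in the function, hence the errors are summable over \<open>p\<close>, and
  Birkhoff's theorem applies to the bounded function \<open>\<C>\<close>.
\<close>

section \<open>The ergodic theorem for bounded functions\<close>

text \<open>Every estimate is tested on functions of oscillation at most one, since both the
  contraction and the Lipschitz assumption are stated there. The gain r ^ p in the comparison with h
  has a specific source: the reference flow and the limiting flow have followed the same environment
  since time 0, so their increments at time q differ by order r ^ q and not only r ^ (q - p).
  Without this, summing over q would leave an error of order one for each p. The term p = 0 has no
  counterpart on the other side, because \<open>K_at\<close> is then constant; it is only bounded.
  Ergodicity is given for strictly invariant sets, so the exceptional set in the ergodic theorem
  must be strictly invariant.\<close>

definition ergodic_map :: "'a measure \<Rightarrow> ('a \<Rightarrow> 'a) \<Rightarrow> bool" where
  "ergodic_map N T \<longleftrightarrow> prob_space N \<and> T \<in> N \<rightarrow>\<^sub>M N \<and> distr N N T = N \<and>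
     (\<forall>A\<in>sets N. T -` A \<inter> space N = A \<longrightarrow> measure N A \<in> {0, 1})"

text \<open>The maximum over k \<le> n of the Birkhoff sums of length k, the empty sum included. The
  recursion through \<open>T x\<close> makes the maximal identity a matter of unfolding.\<close>

primrec max_sum :: "('a \<Rightarrow> 'a) \<Rightarrow> ('a \<Rightarrow> real) \<Rightarrow> nat \<Rightarrow> 'a \<Rightarrow> real" where
  "max_sum T f 0 x = 0"
| "max_sum T f (Suc n) x = max 0 (f x + max_sum T f n (T x))"

lemma max_sum_nonneg: "0 \<le> max_sum T f n x"
  by (cases n) auto

lemma max_sum_mono: "max_sum T f n x \<le> max_sum T f (Suc n) x"
proof (induction n arbitrary: x)
  case (Suc n)
  have "f x + max_sum T f n (T x) \<le> f x + max_sum T f (Suc n) (T x)"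
    using Suc.IH[of "T x"] by simp
  then show ?case unfolding max_sum.simps(2)[of T f _ x] by linarith
qed auto

lemma incseq_max_sum: "incseq (\<lambda>n. max_sum T f n x)"
  by (rule incseq_SucI) (rule max_sum_mono)

lemma ergodic_sum_le_max_sum: "(\<Sum>k<n. f ((T ^^ k) x)) \<le> max_sum T f n x"
proof (induction n arbitrary: x)
  case (Suc n)
  have "(\<Sum>k<Suc n. f ((T ^^ k) x)) = f x + (\<Sum>k<n. f ((T ^^ k) (T x)))"
    by (simp add: sum.lessThan_Suc_shift funpow_swap1 del: sum.lessThan_Suc)
  with Suc[of "T x"] show ?case by simp
qed simp

lemma measurable_max_sum:
  assumes "T \<in> N \<rightarrow>\<^sub>M N" "f \<in> borel_measurable N"
  shows "max_sum T f n \<in> borel_measurable N"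
proof (induction n)
  case (Suc n)
  note Suc[measurable] assms[measurable]
  show ?case unfolding max_sum.simps by measurable
qed simp

lemma max_sum_le:
  assumes "T \<in> N \<rightarrow>\<^sub>M N" "\<And>x. x \<in> space N \<Longrightarrow> \<bar>f x\<bar> \<le> B" "x \<in> space N"
  shows "max_sum T f n x \<le> real n * B"
  using assms(3)
proof (induction n arbitrary: x)
  case (Suc n)
  have "T x \<in> space N" using Suc.prems assms(1) by (auto dest: measurable_space)
  from Suc.IH[OF this] assms(2)[OF Suc.prems]
  have "f x + max_sum T f n (T x) \<le> real (Suc n) * B" by (simp add: algebra_simps)
  moreover have "0 \<le> real (Suc n) * B" using assms(2)[OF Suc.prems] by simp
  ultimately show ?case by simp
qed simp

text \<open>If the maximal sums were unbounded almost surely, the identity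
  \<open>F\<^sub>n\<^sub>+\<^sub>1 - F\<^sub>n \<circ> T = max (- F\<^sub>n \<circ> T) f\<close> would give \<open>0 \<le> \<integral> F\<^sub>n\<^sub>+\<^sub>1 - F\<^sub>n \<longlonglongrightarrow> \<integral> f < 0\<close>.\<close>

lemma ergodic_sums_bounded_above:
  fixes f :: "'a \<Rightarrow> real"
  assumes erg: "ergodic_map N T" and f[measurable]: "f \<in> borel_measurable N"
    and bnd: "\<And>x. x \<in> space N \<Longrightarrow> \<bar>f x\<bar> \<le> B" and neg: "(\<integral>x. f x \<partial>N) < 0"
  shows "AE x in N. \<exists>b. \<forall>n. (\<Sum>k<n. f ((T ^^ k) x)) \<le> b"
proof -
  interpret prob_space N using erg by (simp add: ergodic_map_def)
  have T[measurable]: "T \<in> N \<rightarrow>\<^sub>M N" and inv: "distr N N T = N"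
    using erg by (auto simp: ergodic_map_def)
  have Tsp: "T x \<in> space N" if "x \<in> space N" for x using measurable_space[OF T that] .
  define F where "F = max_sum T f"
  have F_meas[measurable]: "F n \<in> borel_measurable N" for n
    unfolding F_def by (rule measurable_max_sum) auto
  have F_bound: "\<bar>F n x\<bar> \<le> real n * B" if "x \<in> space N" for n x
    using max_sum_le[OF T bnd that, where n=n] max_sum_nonneg[of T f n x] by (simp add: F_def)
  have F_int: "integrable N (F n)" for n
    by (rule integrable_const_bound[of _ "real n * B"]) (auto intro!: AE_I2 F_bound)
  have F_Tint: "integrable N (\<lambda>x. F n (T x))" for n
    by (rule integrable_const_bound[of _ "real n * B"]) (auto intro!: AE_I2 F_bound Tsp)
  have F_T: "(\<integral>x. F n (T x) \<partial>N) = (\<integral>x. F n x \<partial>N)" for n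
    using integral_distr[of T N N "F n"] by (simp add: inv)
  define A where "A = {x \<in> space N. \<forall>b::nat. \<exists>n. real b < F n x}"
  have A[measurable]: "A \<in> sets N" unfolding A_def by measurable
  \<comment> \<open>Passing from x to \<open>T x\<close> shifts the index by one and changes the
    maximal sum by at most \<bar>f x\<bar>, so unboundedness is preserved both ways. Hence A is
    strictly invariant.\<close>
  have A_iff: "(\<forall>b::nat. \<exists>n. real b < F n (T x)) \<longleftrightarrow> (\<forall>b::nat. \<exists>n. real b < F n x)" for x
  proof (intro iffI allI)
    fix b :: nat assume *: "\<forall>b::nat. \<exists>n. real b < F n (T x)"
    obtain b' :: nat where "real b + \<bar>f x\<bar> \<le> real b'" using real_nat_ceiling_ge by blast
    moreover obtain n where "real b' < F n (T x)" using * by blast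
    ultimately have "real b < F (Suc n) x" unfolding F_def by auto
    then show "\<exists>n. real b < F n x" by blast
  next
    fix b :: nat assume *: "\<forall>b::nat. \<exists>n. real b < F n x"
    obtain b' :: nat where b': "real b + \<bar>f x\<bar> \<le> real b'" using real_nat_ceiling_ge by blast
    obtain n where n: "real b' < F n x" using * by blast
    have "real b < F (n - 1) (T x)"
      using n b' by (cases n) (auto simp: F_def)
    then show "\<exists>n. real b < F n (T x)" by blast
  qed
  have "T -` A \<inter> space N = A" using A_iff Tsp by (auto simp: A_def)
  with erg A have "measure N A \<in> {0, 1}" by (auto simp: ergodic_map_def)
  moreover have "measure N A \<noteq> 1"
  proof
    assume "measure N A = 1"
    then have AE: "AE x in N. x \<in> A" using A by (simp add: prob_eq_1)
    \<comment> \<open>On A the maximal sums increase to infinity, so the maximum is eventually f x.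
      As the sums are nonnegative, it always lies between f x and max 0 (f x); this gives the
      dominating constant B.\<close>
    have "(\<lambda>n. \<integral>x. max (- F n (T x)) (f x) \<partial>N) \<longlonglongrightarrow> (\<integral>x. f x \<partial>N)"
    proof (rule integral_dominated_convergence[where w="\<lambda>_. B"])
      show "AE x in N. (\<lambda>n. max (- F n (T x)) (f x)) \<longlonglongrightarrow> f x"
        using AE
      proof eventually_elim
        case (elim x)
        obtain b :: nat where b: "\<bar>f x\<bar> \<le> real b" using real_nat_ceiling_ge by blast
        have "\<forall>b::nat. \<exists>n. real b < F n (T x)" using elim A_iff[of x] by (simp add: A_def)
        then obtain n where n: "real b < F n (T x)" by blast
        have "max (- F m (T x)) (f x) = f x" if "m \<ge> n" for m
          using incseqD[OF incseq_max_sum[of T f "T x"] that] n b by (simp add: F_def)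
        then show ?case by (intro tendsto_eventually eventually_sequentiallyI) auto
      qed
      show "AE x in N. norm (max (- F n (T x)) (f x)) \<le> B" for n
      proof (rule AE_I2)
        fix x assume x: "x \<in> space N"
        then show "norm (max (- F n (T x)) (f x)) \<le> B"
          using bnd[OF x] max_sum_nonneg[of T f n "T x"] by (auto simp: F_def max_def)
      qed
    qed auto
    moreover have "0 \<le> (\<integral>x. max (- F n (T x)) (f x) \<partial>N)" for n
    proof -
      have "(\<integral>x. max (- F n (T x)) (f x) \<partial>N) = (\<integral>x. F (Suc n) x - F n (T x) \<partial>N)"
        by (rule Bochner_Integration.integral_cong) (auto simp: F_def max_def)
      also have "\<dots> = (\<integral>x. F (Suc n) x \<partial>N) - (\<integral>x. F n x \<partial>N)"
        using F_int F_Tint F_T by simp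
      also have "\<dots> \<ge> 0"
      proof -
        have "(\<integral>x. F n x \<partial>N) \<le> (\<integral>x. F (Suc n) x \<partial>N)"
          by (intro integral_mono F_int) (simp add: F_def max_sum_mono del: max_sum.simps)
        then show ?thesis by simp
      qed
      finally show ?thesis .
    qed
    ultimately have "0 \<le> (\<integral>x. f x \<partial>N)" by (intro LIMSEQ_le_const) auto
    with neg show False by simp
  qed
  ultimately have "measure N A = 0" by auto
  then have "AE x in N. x \<notin> A" using A by (simp add: prob_eq_0)
  with AE_space show ?thesis
  proof eventually_elim
    case (elim x)
    then obtain b :: nat where b: "\<And>n. F n x \<le> real b" by (auto simp: A_def not_less)
    have "(\<Sum>k<n. f ((T ^^ k) x)) \<le> real b" for n
      using order_trans[OF ergodic_sum_le_max_sum b[unfolded F_def]] .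
    then show ?case by blast
  qed
qed

text \<open>Recentring f at e / 2 above its mean makes the integral negative, so the recentred sums
  stay below some b. The other e / 2 absorbs b / n for large n.\<close>

lemma ergodic_averages_upper:
  fixes f :: "'a \<Rightarrow> real"
  assumes erg: "ergodic_map N T" and f[measurable]: "f \<in> borel_measurable N"
    and bnd: "\<And>x. x \<in> space N \<Longrightarrow> \<bar>f x\<bar> \<le> B" and e: "0 < e"
  shows "AE x in N. \<forall>\<^sub>F n in sequentially. (\<Sum>k<n. f ((T ^^ k) x)) / real n \<le> (\<integral>x. f x \<partial>N) + e"
proof -
  interpret prob_space N using erg by (simp add: ergodic_map_def)
  define I where "I = (\<integral>x. f x \<partial>N)"
  have int: "integrable N f"
    by (rule integrable_const_bound[of _ B]) (auto intro!: AE_I2 bnd)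
  define d where "d = I + e / 2"
  have "AE x in N. \<exists>b. \<forall>n. (\<Sum>k<n. f ((T ^^ k) x) - d) \<le> b"
  proof (rule ergodic_sums_bounded_above[OF erg])
    show "\<bar>f x - d\<bar> \<le> B + \<bar>d\<bar>" if "x \<in> space N" for x using bnd[OF that] by linarith
    show "(\<integral>x. f x - d \<partial>N) < 0" using int e by (simp add: I_def d_def prob_space)
  qed simp
  then show ?thesis
  proof eventually_elim
    case (elim x)
    then obtain b where b: "\<And>n. (\<Sum>k<n. f ((T ^^ k) x) - d) \<le> b" by blast
    obtain m :: nat where m: "2 * \<bar>b\<bar> / e \<le> real m" using real_nat_ceiling_ge by blast
    show ?case
    proof (rule eventually_sequentiallyI[of "Suc m"])
      fix n assume n: "Suc m \<le> n"
      have "(\<Sum>k<n. f ((T ^^ k) x)) \<le> b + real n * d" using b[of n] by (simp add: sum_subtractf)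
      moreover have "b \<le> real n * (e / 2)"
      proof -
        have "2 * \<bar>b\<bar> / e \<le> real n" using m n by linarith
        then show ?thesis using e by (simp add: field_simps)
      qed
      ultimately have "(\<Sum>k<n. f ((T ^^ k) x)) \<le> real n * (I + e)"
        by (simp add: d_def algebra_simps)
      then show "(\<Sum>k<n. f ((T ^^ k) x)) / real n \<le> (\<integral>x. f x \<partial>N) + e"
        using n by (simp add: I_def field_simps)
    qed
  qed
qed

text \<open>Countably many tolerances keep the exceptional set null, and the upper estimate for - f
  supplies the lower one.\<close>

lemma birkhoff_bounded_ergodic:
  fixes f :: "'a \<Rightarrow> real"
  assumes erg: "ergodic_map N T" and f[measurable]: "f \<in> borel_measurable N"
    and bnd: "\<And>x. x \<in> space N \<Longrightarrow> \<bar>f x\<bar> \<le> B"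
  shows "AE x in N. (\<lambda>n. (\<Sum>k<n. f ((T ^^ k) x)) / real n) \<longlonglongrightarrow> (\<integral>x. f x \<partial>N)"
proof -
  have up: "AE x in N. \<forall>j. \<forall>\<^sub>F n in sequentially.
      (\<Sum>k<n. f ((T ^^ k) x)) / real n \<le> (\<integral>x. f x \<partial>N) + 1 / real (Suc j)"
    unfolding AE_all_countable
    by (intro allI ergodic_averages_upper[OF erg f bnd]) auto
  have "AE x in N. \<forall>j. \<forall>\<^sub>F n in sequentially.
      (\<Sum>k<n. - f ((T ^^ k) x)) / real n \<le> (\<integral>x. - f x \<partial>N) + 1 / real (Suc j)"
    unfolding AE_all_countable
    by (intro allI ergodic_averages_upper[OF erg, of _ B]) (auto simp: bnd)
  with up show ?thesis
  proof eventually_elim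
    case (elim x)
    show ?case
    proof (rule tendstoI)
      fix e :: real assume "0 < e"
      then obtain j where j: "1 / real (Suc j) < e" using nat_approx_posE by blast
      from elim(1)[rule_format, of j] elim(2)[rule_format, of j]
      show "\<forall>\<^sub>F n in sequentially. dist ((\<Sum>k<n. f ((T ^^ k) x)) / real n) (\<integral>x. f x \<partial>N) < e"
      proof eventually_elim
        case (elim n)
        then show ?case using j by (simp add: dist_real_def sum_negf abs_less_iff)
      qed
    qed
  qed
qed

section \<open>Probability measures and bounded measurable functions\<close>

abbreviation (input) Pr :: "'e::topological_space measure set" where
  "Pr \<equiv> space (prob_algebra borel)"

text \<open>Membership in this class discharges integrability against every probability measure, and
  the class is stable under algebra and kernels.\<close>

definition Bb :: "('e::topological_space \<Rightarrow> real) set" where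
  "Bb = {f \<in> borel_measurable borel. bounded (range f)}"

lemma PrD:
  assumes "\<mu> \<in> Pr"
  shows "prob_space \<mu>" "sets \<mu> = sets borel" "space \<mu> = UNIV"
  using assms by (auto simp: space_prob_algebra dest: sets_eq_imp_space_eq)

lemma PrI: "prob_space \<mu> \<Longrightarrow> sets \<mu> = sets borel \<Longrightarrow> \<mu> \<in> Pr"
  by (simp add: space_prob_algebra)

lemma Bb_measurable: "f \<in> Bb \<Longrightarrow> f \<in> borel_measurable borel"
  by (simp add: Bb_def)

lemma BbI: "f \<in> borel_measurable borel \<Longrightarrow> (\<And>x. \<bar>f x\<bar> \<le> B) \<Longrightarrow> f \<in> Bb"
  by (auto simp: Bb_def intro!: boundedI[of _ B])

lemma BbE:
  assumes "f \<in> Bb"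
  obtains B where "0 \<le> B" "\<And>x. \<bar>f x\<bar> \<le> B"
proof -
  obtain B where "\<And>x. \<bar>f x\<bar> \<le> B" using assms by (auto simp: Bb_def bounded_iff)
  then show ?thesis using that[of B] abs_ge_zero order_trans by blast
qed

lemma Bb_const[simp, intro]: "(\<lambda>_. c) \<in> Bb"
  by (rule BbI[of _ "\<bar>c\<bar>"]) auto

lemma Bb_add[intro]:
  assumes "f \<in> Bb" "g \<in> Bb" shows "(\<lambda>x. f x + g x) \<in> Bb"
proof -
  note [measurable] = assms[THEN Bb_measurable]
  obtain B1 B2 where "\<And>x. \<bar>f x\<bar> \<le> B1" "\<And>x. \<bar>g x\<bar> \<le> B2" using assms BbE by metis
  then have "\<bar>f x + g x\<bar> \<le> B1 + B2" for x by (meson abs_triangle_ineq add_mono order_trans)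
  then show ?thesis by (intro BbI) auto
qed

lemma Bb_mult[intro]:
  assumes "f \<in> Bb" "g \<in> Bb" shows "(\<lambda>x. f x * g x) \<in> Bb"
proof -
  note [measurable] = assms[THEN Bb_measurable]
  obtain B1 B2 where B: "\<And>x. \<bar>f x\<bar> \<le> B1" "\<And>x. \<bar>g x\<bar> \<le> B2" "0 \<le> B1" using assms BbE by metis
  then have "\<bar>f x * g x\<bar> \<le> B1 * B2" for x by (simp add: abs_mult mult_mono)
  then show ?thesis by (intro BbI) auto
qed

lemma Bb_uminus[intro]: "f \<in> Bb \<Longrightarrow> (\<lambda>x. - f x) \<in> Bb"
  using Bb_mult[OF Bb_const[of "-1"]] by simp

lemma Bb_diff[intro]: "f \<in> Bb \<Longrightarrow> g \<in> Bb \<Longrightarrow> (\<lambda>x. f x - g x) \<in> Bb"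
  using Bb_add[OF _ Bb_uminus, of f g] by simp

lemma Bb_divide_const[intro]: "f \<in> Bb \<Longrightarrow> (\<lambda>x. f x / c) \<in> Bb"
  using Bb_mult[OF _ Bb_const[of "1 / c"], of f] by simp

lemma integrable_Pr:
  assumes "\<mu> \<in> Pr" "f \<in> Bb"
  shows "integrable \<mu> f"
proof -
  interpret prob_space \<mu> using PrD(1)[OF assms(1)] .
  obtain B where "\<And>x. \<bar>f x\<bar> \<le> B" using BbE[OF assms(2)] by blast
  then show ?thesis
    using assms PrD(2)[OF assms(1)]
    by (intro integrable_const_bound[of _ B]) (auto simp: Bb_def cong: measurable_cong_sets)
qed

lemma integral_Pr_const: "\<mu> \<in> Pr \<Longrightarrow> (\<integral>x. c \<partial>\<mu>) = (c::real)"
  using PrD(1) prob_space.prob_space by fastforce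

lemma integral_Pr_le:
  assumes "\<mu> \<in> Pr" "f \<in> Bb" "\<And>x. f x \<le> c" shows "(\<integral>x. f x \<partial>\<mu>) \<le> c"
  using integral_mono[OF integrable_Pr[OF assms(1,2)] integrable_Pr[OF assms(1) Bb_const[of c]]] assms
  using PrD(1)[OF assms(1)] by (simp add: prob_space.prob_space)

lemma integral_Pr_ge:
  assumes "\<mu> \<in> Pr" "f \<in> Bb" "\<And>x. c \<le> f x" shows "c \<le> (\<integral>x. f x \<partial>\<mu>)"
  using integral_mono[OF integrable_Pr[OF assms(1) Bb_const[of c]] integrable_Pr[OF assms(1,2)]] assms
  using PrD(1)[OF assms(1)] by (simp add: prob_space.prob_space)

lemma integral_Pr_mono:
  assumes "\<mu> \<in> Pr" "f \<in> Bb" "g \<in> Bb" "\<And>x. f x \<le> g x" shows "(\<integral>x. f x \<partial>\<mu>) \<le> (\<integral>x. g x \<partial>\<mu>)"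
  using integral_mono[OF integrable_Pr[OF assms(1,2)] integrable_Pr[OF assms(1,3)]] assms by simp

lemma integral_Pr_abs_diff_le:
  assumes "\<mu> \<in> Pr" "f \<in> Bb" "g \<in> Bb" "\<And>x. \<bar>f x - g x\<bar> \<le> d"
  shows "\<bar>(\<integral>x. f x \<partial>\<mu>) - (\<integral>x. g x \<partial>\<mu>)\<bar> \<le> d"
proof -
  have eq: "(\<integral>x. f x - g x \<partial>\<mu>) = (\<integral>x. f x \<partial>\<mu>) - (\<integral>x. g x \<partial>\<mu>)"
    using integrable_Pr assms by (intro Bochner_Integration.integral_diff) auto
  have "f x - g x \<le> d" "- d \<le> f x - g x" for x using assms(4)[of x] by linarith+
  then have "(\<integral>x. f x - g x \<partial>\<mu>) \<le> d" "- d \<le> (\<integral>x. f x - g x \<partial>\<mu>)"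
    using assms by (auto intro!: integral_Pr_le integral_Pr_ge)
  then show ?thesis using eq by linarith
qed

lemma integral_bind_Pr:
  assumes "\<mu> \<in> Pr" "N \<in> borel \<rightarrow>\<^sub>M prob_algebra borel" "f \<in> Bb"
  shows "(\<integral>x. f x \<partial>(\<mu> \<bind> N)) = (\<integral>x. kernel_op N f x \<partial>\<mu>)"
proof -
  note D = PrD[OF assms(1)]
  interpret prob_space \<mu> by fact
  have N: "N \<in> \<mu> \<rightarrow>\<^sub>M subprob_algebra borel"
    using measurable_prob_algebraD[OF assms(2)] measurable_cong_sets[OF D(2) refl] by blast
  have Nx: "prob_space (N x)" for x
    using measurable_space[OF assms(2), of x] by (simp add: space_prob_algebra)
  obtain B where B: "\<And>x. \<bar>f x\<bar> \<le> B" using BbE[OF assms(3)] by blast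
  show ?thesis unfolding kernel_op_def
    by (rule integral_bind[where B'=1 and B=B, OF _ _ N])
       (use B assms(3) Nx in \<open>auto simp: Bb_def prob_space.emeasure_space_1 finite_measure_axioms\<close>)
qed

lemma bind_Pr: "\<mu> \<in> Pr \<Longrightarrow> N \<in> borel \<rightarrow>\<^sub>M prob_algebra borel \<Longrightarrow> \<mu> \<bind> N \<in> Pr"
  using measurable_space[OF measurable_bind_prob_space[of "\<lambda>_::unit. \<mu>" "count_space UNIV" borel N borel], of "()"]
  by simp


lemma kernel_op_Bb:
  assumes "N \<in> borel \<rightarrow>\<^sub>M prob_algebra borel" "f \<in> Bb"
  shows "kernel_op N f \<in> Bb"
proof -
  obtain B where B: "\<And>x. \<bar>f x\<bar> \<le> B" using BbE[OF assms(2)] by blast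
  have Nx: "N x \<in> Pr" for x using measurable_space[OF assms(1), of x] by simp
  have "kernel_op N f \<in> borel_measurable borel"
    unfolding kernel_op_def[abs_def]
    by (rule measurable_compose[OF measurable_prob_algebraD[OF assms(1)]
          integral_measurable_subprob_algebra[OF Bb_measurable[OF assms(2)]]])
  moreover have "\<bar>kernel_op N f x\<bar> \<le> B" for x
  proof -
    have "f x \<le> B" "- B \<le> f x" for x using B[of x] by linarith+
    then have "(\<integral>z. f z \<partial>N x) \<le> B" "- B \<le> (\<integral>z. f z \<partial>N x)"
      using assms Nx by (auto intro!: integral_Pr_le integral_Pr_ge)
    then show ?thesis unfolding kernel_op_def by linarith
  qed
  ultimately show ?thesis by (rule BbI)
qed

lemma return_Pr: "return borel x \<in> Pr"
  by (auto intro!: PrI prob_space_return)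

lemma integral_return_Bb: "f \<in> Bb \<Longrightarrow> (\<integral>z. f z \<partial>return borel x) = f x"
  by (rule integral_return) (auto simp: Bb_measurable)

text \<open>The lower bound m keeps the normalising integral positive, so that the density has total
  mass one.\<close>

lemma integral_Psi:
  assumes \<mu>: "\<mu> \<in> Pr" and G: "G \<in> Bb" and m: "0 < m" "\<And>x. m \<le> G x"
  shows "Psi G \<mu> \<in> Pr"
    and "f \<in> Bb \<Longrightarrow> (\<integral>x. f x \<partial>Psi G \<mu>) = (\<integral>x. G x * f x \<partial>\<mu>) / (\<integral>x. G x \<partial>\<mu>)"
proof -
  note D = PrD[OF \<mu>]
  interpret prob_space \<mu> by fact
  have [measurable]: "G \<in> borel_measurable \<mu>"
    using Bb_measurable[OF G] D(2) by (simp cong: measurable_cong_sets)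
  define c where "c = (\<integral>x. G x \<partial>\<mu>)"
  have c: "0 < c" using integral_Pr_ge[OF \<mu> G m(2)] m(1) by (simp add: c_def)
  have pos: "0 \<le> G x / c" for x using m(1) m(2)[of x] c by simp
  have int: "integrable \<mu> (\<lambda>x. G x / c)" using integrable_Pr[OF \<mu> G] by simp
  have "emeasure (Psi G \<mu>) (space (Psi G \<mu>)) = (\<integral>\<^sup>+x. ennreal (G x / c) \<partial>\<mu>)"
    unfolding Psi_def c_def[symmetric] by (simp add: emeasure_density cong: nn_integral_cong)
  also have "\<dots> = ennreal (\<integral>x. G x / c \<partial>\<mu>)"
    using pos int by (intro nn_integral_eq_integral) auto
  also have "(\<integral>x. G x / c \<partial>\<mu>) = 1" using c by (simp add: c_def)
  finally have "prob_space (Psi G \<mu>)" by (intro prob_spaceI) simp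
  then show "Psi G \<mu> \<in> Pr" by (intro PrI) (simp_all add: Psi_def D)
  assume f: "f \<in> Bb"
  then have [measurable]: "f \<in> borel_measurable \<mu>"
    using Bb_measurable[OF f] D(2) by (simp cong: measurable_cong_sets)
  have "(\<integral>x. f x \<partial>Psi G \<mu>) = (\<integral>x. (G x / c) *\<^sub>R f x \<partial>\<mu>)"
    unfolding Psi_def c_def[symmetric] using pos by (intro integral_density) auto
  also have "\<dots> = (\<integral>x. G x * f x \<partial>\<mu>) / c" by simp
  finally show "(\<integral>x. f x \<partial>Psi G \<mu>) = (\<integral>x. G x * f x \<partial>\<mu>) / (\<integral>x. G x \<partial>\<mu>)"
    by (simp add: c_def)
qed

section \<open>Oscillation and total variation\<close>

lemma OscD: "f \<in> Osc \<Longrightarrow> \<bar>f x - f y\<bar> \<le> 1"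
proof -
  assume f: "f \<in> Osc"
  have "ereal \<bar>f x - f y\<bar> \<le> osc f" unfolding osc_def by (meson SUP_upper2 UNIV_I order_refl)
  also have "\<dots> \<le> 1" using f by (simp add: Osc_def)
  finally show ?thesis by (simp add: one_ereal_def)
qed

lemma OscI: "f \<in> borel_measurable borel \<Longrightarrow> (\<And>x y. \<bar>f x - f y\<bar> \<le> 1) \<Longrightarrow> f \<in> Osc"
  by (auto simp: Osc_def osc_def one_ereal_def intro!: SUP_least)

lemma Osc_Bb: "f \<in> Osc \<Longrightarrow> f \<in> Bb"
proof -
  assume f: "f \<in> Osc"
  have "\<bar>f x\<bar> \<le> \<bar>f undefined\<bar> + 1" for x using OscD[OF f, of x undefined] by linarith
  then show ?thesis using f by (intro BbI) (auto simp: Osc_def)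
qed

text \<open>For probability measures this bounds the total variation distance, normalised as the
  largest difference of measures of a set. A relation with an explicit bound avoids a supremum of
  reals.\<close>

definition tv_le :: "'e::topological_space measure \<Rightarrow> 'e measure \<Rightarrow> real \<Rightarrow> bool" where
  "tv_le \<mu> \<nu> d \<longleftrightarrow> (\<forall>f\<in>Osc. \<bar>(\<integral>x. f x \<partial>\<mu>) - (\<integral>x. f x \<partial>\<nu>)\<bar> \<le> d)"

lemma tv_leD: "tv_le \<mu> \<nu> d \<Longrightarrow> f \<in> Osc \<Longrightarrow> \<bar>(\<integral>x. f x \<partial>\<mu>) - (\<integral>x. f x \<partial>\<nu>)\<bar> \<le> d"
  by (simp add: tv_le_def)

text \<open>Homogeneity: f / D has oscillation at most one. If D = 0 this division says nothing, but
  then f is constant and both integrals agree.\<close>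

lemma tv_le_scaled:
  assumes "tv_le \<mu> \<nu> d" "\<mu> \<in> Pr" "\<nu> \<in> Pr" "f \<in> borel_measurable borel" "\<And>x y. \<bar>f x - f y\<bar> \<le> D"
  shows "\<bar>(\<integral>x. f x \<partial>\<mu>) - (\<integral>x. f x \<partial>\<nu>)\<bar> \<le> D * d"
proof (cases "0 < D")
  case True
  have "(\<lambda>x. f x / D) \<in> Osc"
    using assms(4,5) True by (intro OscI) (auto simp: diff_divide_distrib[symmetric])
  from tv_leD[OF assms(1) this] have "\<bar>(\<integral>x. f x \<partial>\<mu>) - (\<integral>x. f x \<partial>\<nu>)\<bar> / D \<le> d"
    using True by (simp add: diff_divide_distrib[symmetric])
  then show ?thesis using True by (simp add: field_simps)
next
  case False
  then have "D = 0" using assms(5)[of undefined undefined] by simp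
  then have "f x = f undefined" for x using assms(5)[of x undefined] by simp
  then have "f = (\<lambda>_. f undefined)" by auto
  then have "(\<integral>x. f x \<partial>\<mu>) = f undefined" "(\<integral>x. f x \<partial>\<nu>) = f undefined"
    using integral_Pr_const[OF assms(2), of "f undefined"]
      integral_Pr_const[OF assms(3), of "f undefined"] by metis+
  then show ?thesis using \<open>D = 0\<close> by simp
qed

text \<open>A function with values in \<open>[0, 1]\<close> is within \<open>1 / k\<close> of the average of the indicators of
  its superlevel sets at the heights \<open>j / k\<close>.\<close>

lemma tv_leI_sets:
  assumes "\<mu> \<in> Pr" "\<nu> \<in> Pr" "\<And>A. A \<in> sets borel \<Longrightarrow> \<bar>measure \<mu> A - measure \<nu> A\<bar> \<le> d"
  shows "tv_le \<mu> \<nu> d"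
  unfolding tv_le_def
proof
  fix f :: "'a \<Rightarrow> real" assume f: "f \<in> Osc"
  have [measurable]: "f \<in> borel_measurable borel" using f by (simp add: Osc_def)
  \<comment> \<open>Subtracting the infimum moves f into [0, 1] and leaves the difference of the
    integrals unchanged, as both measures have mass one.\<close>
  define c where "c = (INF x. f x)"
  have bdd: "bdd_below (range f)"
  proof (rule bdd_belowI2)
    show "f undefined - 1 \<le> f y" for y using OscD[OF f, of undefined y] by linarith
  qed
  define u where "u = (\<lambda>x. f x - c)"
  have u0: "0 \<le> u x" for x using bdd by (auto simp: u_def c_def intro: cINF_lower)
  have u1: "u x \<le> 1" for x
  proof -
    have "f x - 1 \<le> c" unfolding c_def
      by (rule cINF_greatest) (use OscD[OF f, of x] in \<open>auto simp: abs_le_iff algebra_simps\<close>)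
    then show ?thesis by (simp add: u_def)
  qed
  have [measurable]: "u \<in> borel_measurable borel" by (simp add: u_def)
  have u_Bb: "u \<in> Bb" using u0 u1 by (intro BbI[of _ 1]) auto
  define s where "s k x = (\<Sum>j\<in>{1..k}. indicator {x. real j \<le> real k * u x} x) / real k" for k :: nat and x
  have s_eq: "s k x = real (nat \<lfloor>real k * u x\<rfloor>) / real k" for k x
  proof -
    have "{j\<in>{1..k}. real j \<le> real k * u x} = {1..nat \<lfloor>real k * u x\<rfloor>}"
    proof (intro set_eqI iffI)
      fix j assume "j \<in> {1..nat \<lfloor>real k * u x\<rfloor>}"
      then have "1 \<le> j" "real j \<le> real k * u x"
        by (auto simp: le_nat_iff le_floor_iff u0)
      moreover have "real k * u x \<le> real k" using u1[of x] by (simp add: mult_left_le)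
      ultimately show "j \<in> {j\<in>{1..k}. real j \<le> real k * u x}" by auto
    qed (auto simp: le_nat_iff le_floor_iff u0)
    moreover have "(\<Sum>j\<in>{1..k}. indicator {x. real j \<le> real k * u x} x) =
        real (card {j\<in>{1..k}. real j \<le> real k * u x})"
      by (simp add: indicator_def sum.If_cases Int_def)
    ultimately show ?thesis by (simp add: s_def)
  qed
  have s_close: "\<bar>u x - s k x\<bar> \<le> 1 / real k" if "0 < k" for k x
  proof -
    have "\<bar>real k * u x - real (nat \<lfloor>real k * u x\<rfloor>)\<bar> / real k \<le> 1 / real k"
    proof (rule divide_right_mono)
      have "real (nat \<lfloor>real k * u x\<rfloor>) = of_int \<lfloor>real k * u x\<rfloor>" by (simp add: u0)
      then show "\<bar>real k * u x - real (nat \<lfloor>real k * u x\<rfloor>)\<bar> \<le> 1" by linarith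
    qed simp
    moreover have "u x - s k x = (real k * u x - real (nat \<lfloor>real k * u x\<rfloor>)) / real k"
      using that by (simp add: s_eq diff_divide_distrib)
    ultimately show ?thesis by simp
  qed
  have ind: "indicator {x. real j \<le> real k * u x} \<in> (Bb :: ('a \<Rightarrow> real) set)" for j k :: nat
    by (rule BbI[of _ 1]) (auto simp: indicator_def)
  have s_Bb: "s k \<in> Bb" for k
  proof -
    have "(\<lambda>x. \<Sum>j\<in>J. indicator {x. real j \<le> real k * u x} x) \<in> Bb" if "finite J" for J
      using that by induction (auto intro: Bb_add ind)
    then show ?thesis unfolding s_def[abs_def] by (intro Bb_divide_const) auto
  qed
  have s_int: "(\<integral>x. s k x \<partial>\<rho>) = (\<Sum>j\<in>{1..k}. measure \<rho> {x. real j \<le> real k * u x}) / real k"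
    if "\<rho> \<in> Pr" for \<rho> k
    unfolding s_def using integrable_Pr[OF that ind] PrD(3)[OF that]
    by (simp add: Bochner_Integration.integral_sum)
  \<comment> \<open>\<open>Suc k\<close> avoids division by zero. Each of the two measures
    contributes one approximation error 1 / \<open>Suc k\<close>, hence the 2.\<close>
  have main: "\<bar>(\<integral>x. u x \<partial>\<mu>) - (\<integral>x. u x \<partial>\<nu>)\<bar> \<le> d + 2 / real (Suc k)" for k
  proof -
    let ?k = "Suc k"
    have 1: "\<bar>(\<integral>x. u x \<partial>\<rho>) - (\<integral>x. s ?k x \<partial>\<rho>)\<bar> \<le> 1 / real ?k" if "\<rho> \<in> Pr" for \<rho>
      using that by (intro integral_Pr_abs_diff_le s_close u_Bb s_Bb) auto
    have "\<bar>(\<integral>x. s ?k x \<partial>\<mu>) - (\<integral>x. s ?k x \<partial>\<nu>)\<bar> =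
        \<bar>\<Sum>j\<in>{1..?k}. measure \<mu> {x. real j \<le> real ?k * u x} - measure \<nu> {x. real j \<le> real ?k * u x}\<bar> / real ?k"
      using assms by (simp add: s_int sum_subtractf diff_divide_distrib[symmetric])
    also have "\<dots> \<le> (\<Sum>j\<in>{1..?k}. d) / real ?k"
      by (intro divide_right_mono order_trans[OF sum_abs] sum_mono assms(3)) auto
    also have "\<dots> = d" by simp
    finally show ?thesis using 1[OF assms(1)] 1[OF assms(2)] by linarith
  qed
  have "(\<lambda>k. d + 2 / real (Suc k)) \<longlonglongrightarrow> d + 0"
    by (intro tendsto_intros LIMSEQ_Suc lim_const_over_n)
  then have "\<bar>(\<integral>x. u x \<partial>\<mu>) - (\<integral>x. u x \<partial>\<nu>)\<bar> \<le> d"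
    using main by (intro LIMSEQ_le_const[of _ d]) auto
  moreover have "(\<integral>x. u x \<partial>\<rho>) = (\<integral>x. f x \<partial>\<rho>) - c" if "\<rho> \<in> Pr" for \<rho>
    unfolding u_def using integrable_Pr[OF that Osc_Bb[OF f]] integrable_Pr[OF that Bb_const, of c]
    by (simp add: prob_space.prob_space[OF PrD(1)[OF that]])
  ultimately show "\<bar>(\<integral>x. f x \<partial>\<mu>) - (\<integral>x. f x \<partial>\<nu>)\<bar> \<le> d" using assms(1,2) by simp
qed

text \<open>Completeness in total variation, with the rate kept. Setwise limits exist and are
  finitely additive; countable additivity reduces to continuity at the empty set, where L is within
  \<open>e n\<close> of the genuine measure \<open>\<mu> n\<close>, uniformly over all sets.\<close>

lemma tv_Cauchy_limit:
  fixes \<mu> :: "nat \<Rightarrow> 'e::topological_space measure"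
  assumes \<mu>: "\<And>n. \<mu> n \<in> Pr" and tv: "\<And>n m. n \<le> m \<Longrightarrow> tv_le (\<mu> n) (\<mu> m) (e n)" and e: "e \<longlonglongrightarrow> 0"
  shows "\<exists>\<nu>\<in>Pr. \<forall>n. tv_le (\<mu> n) \<nu> (e n)"
proof -
  have sets[simp]: "sets (\<mu> n) = sets borel" "space (\<mu> n) = UNIV" for n using PrD[OF \<mu>] by auto
  have prob: "prob_space (\<mu> n)" for n using PrD[OF \<mu>] by auto
  have d: "\<bar>measure (\<mu> n) A - measure (\<mu> m) A\<bar> \<le> e n" if "n \<le> m" and A[measurable]: "A \<in> sets borel" for n m A
  proof -
    have "indicator A \<in> Osc" by (intro OscI) (auto simp: indicator_def)
    from tv_leD[OF tv[OF that(1)] this] show ?thesis by simp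
  qed
  define L where "L A = lim (\<lambda>n. measure (\<mu> n) A)" for A
  have L: "(\<lambda>n. measure (\<mu> n) A) \<longlonglongrightarrow> L A" if A: "A \<in> sets borel" for A
  proof -
    have "Cauchy (\<lambda>n. measure (\<mu> n) A)"
    proof (rule metric_CauchyI)
      fix r :: real assume "0 < r"
      then have "\<forall>\<^sub>F n in sequentially. e n < r / 2" using e by (intro order_tendstoD(2)[OF e]) auto
      then obtain n where n: "e n < r / 2" by (auto simp: eventually_sequentially)
      have "dist (measure (\<mu> k) A) (measure (\<mu> l) A) < r" if "n \<le> k" "n \<le> l" for k l
        using d[OF that(1) A] d[OF that(2) A] n by (simp add: dist_real_def)
      then show "\<exists>n. \<forall>k\<ge>n. \<forall>l\<ge>n. dist (measure (\<mu> k) A) (measure (\<mu> l) A) < r" by blast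
    qed
    then show ?thesis unfolding L_def by (simp add: Cauchy_convergent_iff convergent_LIMSEQ_iff)
  qed
  have L_close: "\<bar>measure (\<mu> n) A - L A\<bar> \<le> e n" if A: "A \<in> sets borel" for n A
  proof (rule LIMSEQ_le_const2)
    show "(\<lambda>m. \<bar>measure (\<mu> n) A - measure (\<mu> m) A\<bar>) \<longlonglongrightarrow> \<bar>measure (\<mu> n) A - L A\<bar>"
      by (intro tendsto_intros L A)
  qed (use d[OF _ A] in blast)
  have L_nonneg: "0 \<le> L A" if "A \<in> sets borel" for A
    by (rule LIMSEQ_le_const[OF L[OF that]]) auto
  define \<nu> where "\<nu> = measure_of (UNIV::'e set) (sets borel) (\<lambda>A. ennreal (L A))"
  have sets_\<nu>: "sets \<nu> = sets borel"
    unfolding \<nu>_def using sets.sigma_sets_eq[of "borel :: 'e measure"] by simp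
  have L_Un: "L (A \<union> B) = L A + L B" if "A \<in> sets borel" "B \<in> sets borel" "A \<inter> B = {}" for A B
  proof (rule LIMSEQ_unique[OF L])
    have "measure (\<mu> n) (A \<union> B) = measure (\<mu> n) A + measure (\<mu> n) B" for n
      using that prob_space.axioms(1)[OF prob, THEN finite_measure.finite_measure_Union, of A n B] by simp
    then show "(\<lambda>n. measure (\<mu> n) (A \<union> B)) \<longlonglongrightarrow> L A + L B"
      using tendsto_add[OF L[OF that(1)] L[OF that(2)]] by simp
  qed (use that in auto)
  have pos: "positive (sets borel) (\<lambda>A. ennreal (L A))"
    using LIMSEQ_unique[OF L[of "{}"], of 0] by (simp add: positive_def)
  have "countably_additive (sets borel) (\<lambda>A::'e set. ennreal (L A))"
  proof (rule ring_of_sets.empty_continuous_imp_countably_additive)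
    show "ring_of_sets UNIV (sets (borel :: 'e measure))"
      using sets.ring_of_sets_axioms[of "borel :: 'e measure"] by simp
    show "Measure_Space.additive (sets borel) (\<lambda>A::'e set. ennreal (L A))"
      by (auto simp: additive_def L_Un L_nonneg ennreal_plus[symmetric] simp del: ennreal_plus)
    fix A :: "nat \<Rightarrow> 'e set" assume A: "range A \<subseteq> sets borel" "decseq A" "(\<Inter>i. A i) = {}"
    have "(\<lambda>i. L (A i)) \<longlonglongrightarrow> 0"
    proof (rule tendstoI)
      fix r :: real assume "0 < r"
      then have "\<forall>\<^sub>F n in sequentially. e n < r / 2" using e by (intro order_tendstoD(2)[OF e]) auto
      then obtain n where n: "e n < r / 2" by (auto simp: eventually_sequentially)
      have "(\<lambda>i. measure (\<mu> n) (A i)) \<longlonglongrightarrow> measure (\<mu> n) (\<Inter>i. A i)"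
        using A by (intro finite_measure.finite_Lim_measure_decseq prob_space.axioms(1)[OF prob]) auto
      then have "\<forall>\<^sub>F i in sequentially. measure (\<mu> n) (A i) < r / 2"
        using A(3) \<open>0 < r\<close> by (intro order_tendstoD) auto
      then show "\<forall>\<^sub>F i in sequentially. dist (L (A i)) 0 < r"
      proof eventually_elim
        case (elim i)
        have "A i \<in> sets borel" using A(1) by auto
        from L_close[OF this, of n] L_nonneg[OF this] show ?case
          using n elim by (simp add: dist_real_def)
      qed
    qed
    then show "(\<lambda>i. ennreal (L (A i))) \<longlonglongrightarrow> 0" using tendsto_ennrealI by fastforce
  qed (use pos in auto)
  then have em: "emeasure \<nu> A = ennreal (L A)" if "A \<in> sets borel" for A
    unfolding \<nu>_def using that pos
    by (intro emeasure_measure_of_sigma) (auto simp: sets.sigma_algebra_axioms[of "borel :: 'e measure", simplified])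
  have meas: "measure \<nu> A = L A" if "A \<in> sets borel" for A
    using em[OF that] L_nonneg[OF that] by (simp add: measure_def)
  have "L UNIV = 1"
    using LIMSEQ_unique[OF L[of UNIV], of 1] prob_space.prob_space[OF prob] by simp
  moreover have "space \<nu> = UNIV" by (simp add: \<nu>_def space_measure_of_conv)
  ultimately have "prob_space \<nu>" using em[of UNIV] by (intro prob_spaceI) simp
  then have \<nu>: "\<nu> \<in> Pr" using sets_\<nu> by (rule PrI)
  have "tv_le (\<mu> n) \<nu> (e n)" for n
    using L_close meas by (intro tv_leI_sets \<mu> \<nu>) auto
  with \<nu> show ?thesis by blast
qed

text \<open>The functions max 0 (1 - k * dist (x, C)) are continuous and bounded and converge to the
  indicator of the closed set C; closed sets form an intersection-stable generator.\<close>

lemma Pr_eqI_continuous: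
  fixes \<mu> \<nu> :: "'e::metric_space measure"
  assumes "\<mu> \<in> Pr" "\<nu> \<in> Pr"
    and eq: "\<And>f :: 'e \<Rightarrow> real. continuous_on UNIV f \<Longrightarrow> bounded (range f) \<Longrightarrow>
      (\<integral>x. f x \<partial>\<mu>) = (\<integral>x. f x \<partial>\<nu>)"
  shows "\<mu> = \<nu>"
proof -
  have meas_eq: "measure \<mu> C = measure \<nu> C" if C: "closed C" for C
  \<comment> \<open>\<open>infdist x {}\<close> is 0 by convention, so the approximation would
    converge to 1 instead of 0 for the empty set.\<close>
  proof (cases "C = {}")
    case False
    define u where "u k x = max 0 (1 - real k * infdist x C)" for k x
    have u_cont: "continuous_on UNIV (u k)" for k
      unfolding u_def[abs_def] by (intro continuous_intros)
    have u_bd: "0 \<le> u k x \<and> u k x \<le> 1" for k x by (simp add: u_def infdist_nonneg)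
    have u_meas[measurable]: "u k \<in> borel_measurable borel" for k
      using u_cont by (rule borel_measurable_continuous_onI)
    have lim: "(\<lambda>k. u k x) \<longlonglongrightarrow> indicator C x" for x
    proof (cases "x \<in> C")
      case True
      then show ?thesis by (simp add: u_def infdist_zero)
    next
      case notin: False
      then have pos: "0 < infdist x C"
        using C False in_closed_iff_infdist_zero[OF C False, of x] infdist_nonneg[of x C] by simp
      obtain m :: nat where m: "1 / infdist x C \<le> real m" using real_nat_ceiling_ge by blast
      have "u k x = 0" if "m \<le> k" for k
      proof -
        have "1 / infdist x C \<le> real k" using m that by linarith
        then show ?thesis using pos by (simp add: u_def field_simps)
      qed
      then show ?thesis using notin by (intro tendsto_eventually eventually_sequentiallyI[of m]) auto
    qed
    have conv: "(\<lambda>k. \<integral>x. u k x \<partial>\<rho>) \<longlonglongrightarrow> measure \<rho> C" if \<rho>: "\<rho> \<in> Pr" for \<rho>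
    proof -
      interpret prob_space \<rho> using PrD(1)[OF \<rho>] .
      have [measurable_cong]: "sets \<rho> = sets borel" using PrD(2)[OF \<rho>] .
      have [measurable]: "C \<in> sets borel" using C by simp
      have "(\<lambda>k. \<integral>x. u k x \<partial>\<rho>) \<longlonglongrightarrow> (\<integral>x. indicator C x \<partial>\<rho>)"
        by (rule integral_dominated_convergence[where w="\<lambda>_. 1"]) (auto simp: lim u_bd)
      then show ?thesis using PrD(3)[OF \<rho>] by simp
    qed
    have "(\<integral>x. u k x \<partial>\<mu>) = (\<integral>x. u k x \<partial>\<nu>)" for k
      using u_bd by (intro eq u_cont) (auto intro!: boundedI[of _ 1])
    then show ?thesis using LIMSEQ_unique[OF conv[OF assms(1)]] conv[OF assms(2)] by simp
  qed simp
  interpret m: prob_space \<mu> using PrD(1)[OF assms(1)] .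
  interpret n: prob_space \<nu> using PrD(1)[OF assms(2)] .
  show ?thesis
  proof (rule measure_eqI_generator_eq[where E="Collect closed" and \<Omega>=UNIV and A="\<lambda>_. UNIV"])
    show "sets \<mu> = sigma_sets UNIV (Collect closed)" "sets \<nu> = sigma_sets UNIV (Collect closed)"
      using PrD(2)[OF assms(1)] PrD(2)[OF assms(2)] by (simp_all add: borel_eq_closed)
  qed (auto simp: Int_stable_def m.emeasure_eq_measure n.emeasure_eq_measure meas_eq)
qed

section \<open>Feynman-Kac flows\<close>

text \<open>The last coordinate is integrated out first, given the path before it. This is the only
  fact about path laws that the recursion for \<open>Q_op\<close> needs beyond measurability and
  total mass.\<close>

lemma (in Ionescu_Tulcea) integral_C_Suc:
  fixes F :: "(nat \<Rightarrow> 'a) \<Rightarrow> real"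
  assumes \<omega>: "\<omega> \<in> space (PiM {0..<n} M)" and F[measurable]: "F \<in> borel_measurable (PiM {0..<Suc (n + m)} M)"
    and B: "\<And>x. \<bar>F x\<bar> \<le> B"
  shows "(\<integral>u. F u \<partial>C n (Suc m) \<omega>) = (\<integral>u. (\<integral>z. F (u(n + m := z)) \<partial>P (n + m) u) \<partial>C n m \<omega>)"
proof -
  interpret C: prob_space "C n m \<omega>" using prob_space_C[OF \<omega>] .
  have eP: "eP (n + m) \<in> C n m \<omega> \<rightarrow>\<^sub>M subprob_algebra (PiM {0..<Suc (n + m)} M)"
    using measurable_eP[of "n + m"] measurable_cong_sets[OF sets_C[OF \<omega>] refl] by blast
  have "(\<integral>u. F u \<partial>C n (Suc m) \<omega>) = (\<integral>u. (\<integral>v. F v \<partial>eP (n + m) u) \<partial>C n m \<omega>)"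
    unfolding C.simps
    by (rule integral_bind[where B'=1 and B=B, OF F _ eP])
       (auto simp: B prob_space_eP space_C[OF \<omega>] prob_space.emeasure_space_1 C.finite_measure_axioms)
  also have "\<dots> = (\<integral>u. (\<integral>z. F (u(n + m := z)) \<partial>P (n + m) u) \<partial>C n m \<omega>)"
  proof (rule Bochner_Integration.integral_cong[OF refl])
    fix u assume "u \<in> space (C n m \<omega>)"
    then have u: "u \<in> space (PiM {0..<n + m} M)" by (simp add: space_C[OF \<omega>])
    have "fun_upd u (n + m) \<in> M (n + m) \<rightarrow>\<^sub>M PiM {0..<Suc (n + m)} M"
      using u by (intro measurable_fun_upd[where J="{0..<n + m}"]) auto
    then have "fun_upd u (n + m) \<in> P (n + m) u \<rightarrow>\<^sub>M PiM {0..<Suc (n + m)} M"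
      using measurable_cong_sets[OF sets_P[OF u] refl] by blast
    then show "(\<integral>v. F v \<partial>eP (n + m) u) = (\<integral>z. F (u(n + m := z)) \<partial>P (n + m) u)"
      unfolding eP_def by (rule integral_distr) simp
  qed
  finally show ?thesis .
qed

section \<open>Environments and the Feynman-Kac semigroup\<close>

lemma env_shift_in_space: "y \<in> space (env_space S) \<Longrightarrow> env_shift k y \<in> space (env_space S)"
  by (auto simp: space_PiM env_shift_def PiE_iff)

lemma env_shift_env_shift: "env_shift k (env_shift l y) = env_shift (k + l) y"
  by (simp add: env_shift_def add.assoc)

lemma env_shift_0[simp]: "env_shift 0 y = y"
  by (simp add: env_shift_def)

text \<open>The assumptions in the form in which they are used: r is the contraction factor per
  step, and the ratio of extrema of G becomes a positive m with m \<le> G \<le> g * m.\<close>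

locale fk_env =
  fixes S :: "'s measure" and M :: "'s \<Rightarrow> 'e::polish_space \<Rightarrow> 'e measure" and G :: "'s \<Rightarrow> 'e \<Rightarrow> real"
    and g a r :: real
  assumes M_kernel: "\<And>s. s \<in> space S \<Longrightarrow> M s \<in> borel \<rightarrow>\<^sub>M prob_algebra borel"
    and G_Bb: "\<And>s. s \<in> space S \<Longrightarrow> G s \<in> Bb"
    and G_bounds: "\<And>s. s \<in> space S \<Longrightarrow> \<exists>m>0. \<forall>x. m \<le> G s x \<and> G s x \<le> g * m"
    and r: "0 < r" "r < 1"
    and dobrushin_P: "\<And>y p n. y \<in> space (env_space S) \<Longrightarrow> p \<le> n \<Longrightarrow>
           dobrushin (P_op M G y p n) \<le> ereal (a * r ^ (n - p))"
begin

abbreviation "Env \<equiv> space (env_space S)"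
abbreviation "Q \<equiv> Q_op M G"
abbreviation "\<Phi> \<equiv> Phi M G"

lemma EnvD: "y \<in> Env \<Longrightarrow> y k \<in> space S"
  by (auto simp: space_PiM)

lemma M_at_kernel: "y \<in> Env \<Longrightarrow> M_at M y n \<in> borel \<rightarrow>\<^sub>M prob_algebra borel"
  by (simp add: M_at_def M_kernel EnvD)

lemma G_at_Bb: "y \<in> Env \<Longrightarrow> G_at G y n \<in> Bb"
  by (simp add: G_at_def G_Bb EnvD)

lemma G_at_bounds: "y \<in> Env \<Longrightarrow> \<exists>m>0. \<forall>x. m \<le> G_at G y n x \<and> G_at G y n x \<le> g * m"
  using G_bounds[OF EnvD, of y "int n"] by (simp add: G_at_def)

context
  fixes y assumes y: "y \<in> Env"
begin

definition chain_kernel :: "nat \<Rightarrow> 'e \<Rightarrow> nat \<Rightarrow> (nat \<Rightarrow> 'e) \<Rightarrow> 'e measure" where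
  "chain_kernel p x i \<omega> = (case i of 0 \<Rightarrow> return borel x | Suc j \<Rightarrow> M_at M y (p + i) (\<omega> j))"

lemma Ionescu_Tulcea_chain: "Ionescu_Tulcea (chain_kernel p x) (\<lambda>_. borel)"
proof -
  have *: "chain_kernel p x i \<in> PiM {0..<i} (\<lambda>_. borel) \<rightarrow>\<^sub>M prob_algebra borel" for i
  proof (cases i)
    case 0
    then show ?thesis using return_Pr by (auto simp: chain_kernel_def[abs_def])
  next
    case (Suc j)
    then have "(\<lambda>\<omega>. \<omega> j) \<in> PiM {0..<i} (\<lambda>_. borel :: 'e measure) \<rightarrow>\<^sub>M borel"
      by (intro measurable_component_singleton) auto
    from measurable_compose[OF this M_at_kernel[OF y]] show ?thesis
      unfolding chain_kernel_def[abs_def] by (simp add: Suc)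
  qed
  show ?thesis
  proof (rule Ionescu_Tulcea.intro)
    fix i
    show "chain_kernel p x i \<in> PiM {0..<i} (\<lambda>_. borel) \<rightarrow>\<^sub>M subprob_algebra borel"
      by (rule measurable_prob_algebraD[OF *])
    fix \<omega> assume "\<omega> \<in> space (PiM {0..<i} (\<lambda>_. borel :: 'e measure))"
    then show "prob_space (chain_kernel p x i \<omega>)"
      using measurable_space[OF *] by (simp add: space_prob_algebra)
  qed
qed

lemma chain_law_eq: "chain_law M y p x m = Ionescu_Tulcea.C (chain_kernel p x) (\<lambda>_. borel) 0 (Suc m) (\<lambda>_. undefined)"
  unfolding chain_law_def chain_kernel_def[abs_def] ..

lemma path_weight_bounded:
  assumes "f \<in> Bb"
  shows "\<exists>B. \<forall>X. \<bar>f (X (n - p)) * (\<Prod>q\<in>{p..<n}. G_at G y q (X (q - p)))\<bar> \<le> B"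
proof -
  obtain B where B: "0 \<le> B" "\<And>x. \<bar>f x\<bar> \<le> B" using BbE[OF assms] by blast
  have "\<forall>q. \<exists>b. \<forall>x. \<bar>G_at G y q x\<bar> \<le> b" using BbE[OF G_at_Bb[OF y]] by metis
  then obtain b where b: "\<And>q x. \<bar>G_at G y q x\<bar> \<le> b q" by metis
  have "\<bar>f (X (n - p)) * (\<Prod>q\<in>{p..<n}. G_at G y q (X (q - p)))\<bar> \<le> B * (\<Prod>q\<in>{p..<n}. b q)" for X
    unfolding abs_mult abs_prod by (intro mult_mono B prod_mono conjI b prod_nonneg) auto
  then show ?thesis by blast
qed

lemma path_weight_measurable:
  assumes "f \<in> Bb"
  shows "(\<lambda>X. f (X (n - p)) * (\<Prod>q\<in>{p..<n}. G_at G y q (X (q - p))))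
     \<in> borel_measurable (PiM {0..<Suc (n - p)} (\<lambda>_. borel))"
proof -
  have *: "(\<lambda>X. u (X i)) \<in> borel_measurable (PiM {0..<Suc (n - p)} (\<lambda>_. borel :: 'e measure))"
    if "u \<in> Bb" "i \<le> n - p" for u :: "'e \<Rightarrow> real" and i
  proof -
    have "(\<lambda>X. X i) \<in> PiM {0..<Suc (n - p)} (\<lambda>_. borel :: 'e measure) \<rightarrow>\<^sub>M borel"
      using that(2) by (intro measurable_component_singleton) auto
    from measurable_compose[OF this Bb_measurable[OF that(1)]] show ?thesis .
  qed
  show ?thesis
    using assms G_at_Bb[OF y] by (intro borel_measurable_times borel_measurable_prod *) auto
qed

lemma Q_refl: "f \<in> Bb \<Longrightarrow> Q y p p f x = f x"
proof -
  assume f: "f \<in> Bb"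
  interpret Ionescu_Tulcea "chain_kernel p x" "\<lambda>_. borel" by (rule Ionescu_Tulcea_chain)
  obtain B where B: "\<And>x. \<bar>f x\<bar> \<le> B" using BbE[OF f] by blast
  have "Q y p p f x = (\<integral>X. f (X 0) \<partial>C 0 (Suc 0) (\<lambda>_. undefined))"
    by (simp add: Q_op_def chain_law_eq)
  also have "\<dots> = (\<integral>u. (\<integral>z. f ((u(0 + 0 := z)) 0) \<partial>chain_kernel p x (0 + 0) u) \<partial>C 0 0 (\<lambda>_. undefined))"
    by (rule integral_C_Suc) (use B path_weight_measurable[OF f, of 0 0] in \<open>auto simp: space_PiM\<close>)
  also have "\<dots> = (\<integral>u. f x \<partial>C 0 0 (\<lambda>_. undefined))"
    by (simp add: chain_kernel_def integral_return_Bb[OF f] del: C.simps lebesgue_integral_const)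
  also have "\<dots> = f x"
  proof -
    have "prob_space (C 0 0 (\<lambda>_. undefined))" by (rule prob_space_C) (simp add: space_PiM)
    then show ?thesis by (simp add: prob_space.prob_space del: C.simps)
  qed
  finally show ?thesis .
qed

lemma Q_Suc:
  assumes f: "f \<in> Bb" and pn: "p \<le> n"
  shows "Q y p (Suc n) f x = Q y p n (\<lambda>x. G_at G y n x * kernel_op (M_at M y (Suc n)) f x) x"
proof -
  interpret Ionescu_Tulcea "chain_kernel p x" "\<lambda>_. borel" by (rule Ionescu_Tulcea_chain)
  define W where "W k X = (\<Prod>q\<in>{p..<k}. G_at G y q (X (q - p)))" for k X
  obtain B where B: "\<forall>X. \<bar>f (X (Suc n - p)) * W (Suc n) X\<bar> \<le> B"
    using path_weight_bounded[OF f, of "Suc n" p] unfolding W_def by (elim exE)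
  have np: "Suc n - p = Suc (n - p)" using pn by simp
  have "Q y p (Suc n) f x = (\<integral>X. f (X (Suc n - p)) * W (Suc n) X \<partial>C 0 (Suc (Suc n - p)) (\<lambda>_. undefined))"
    by (simp add: Q_op_def chain_law_eq W_def)
  also have "\<dots> = (\<integral>u. (\<integral>z. f ((u(0 + (Suc n - p) := z)) (Suc n - p)) * W (Suc n) (u(0 + (Suc n - p) := z))
      \<partial>chain_kernel p x (0 + (Suc n - p)) u) \<partial>C 0 (Suc n - p) (\<lambda>_. undefined))"
    by (rule integral_C_Suc) (use B path_weight_measurable[OF f, of "Suc n" p] in \<open>auto simp: space_PiM W_def\<close>)
  also have "\<dots> = (\<integral>u. (G_at G y n (u (n - p)) * kernel_op (M_at M y (Suc n)) f (u (n - p))) * W n u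
      \<partial>C 0 (Suc n - p) (\<lambda>_. undefined))"
  proof (rule Bochner_Integration.integral_cong[OF refl])
    fix u
    \<comment> \<open>The new state sits at coordinate n + 1 - p, whereas the weights read only
      coordinates up to n - p.\<close>
    have "W (Suc n) (u(Suc n - p := z)) = W n u * G_at G y n (u (n - p))" for z
    proof -
      have "(\<Prod>q\<in>{p..<n}. G_at G y q ((u(Suc n - p := z)) (q - p))) = W n u"
        unfolding W_def by (intro prod.cong refl) auto
      then show ?thesis using pn by (simp add: W_def np del: fun_upd_apply) (simp add: np)
    qed
    then show "(\<integral>z. f ((u(0 + (Suc n - p) := z)) (Suc n - p)) * W (Suc n) (u(0 + (Suc n - p) := z))
      \<partial>chain_kernel p x (0 + (Suc n - p)) u) =
      (G_at G y n (u (n - p)) * kernel_op (M_at M y (Suc n)) f (u (n - p))) * W n u"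
      using pn by (simp add: np chain_kernel_def kernel_op_def)
  qed
  also have "\<dots> = Q y p n (\<lambda>x. G_at G y n x * kernel_op (M_at M y (Suc n)) f x) x"
    by (simp add: Q_op_def chain_law_eq W_def np)
  finally show ?thesis .
qed

lemma GM_Bb: "f \<in> Bb \<Longrightarrow> (\<lambda>x. G_at G y n x * kernel_op (M_at M y (Suc n)) f x) \<in> Bb"
  by (rule Bb_mult[OF G_at_Bb[OF y] kernel_op_Bb[OF M_at_kernel[OF y]]])

lemma M_at_Pr: "M_at M y n x \<in> Pr"
  using measurable_space[OF M_at_kernel[OF y], of x n] by simp

lemma kernel_op_const: "kernel_op (M_at M y n) (\<lambda>_. c) x = c"
  unfolding kernel_op_def by (rule integral_Pr_const[OF M_at_Pr])

lemma Q_Bb: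
  assumes "p \<le> n" "f \<in> Bb" shows "Q y p n f \<in> Bb"
  using assms
proof (induction n arbitrary: f rule: dec_induct)
  case base
  have "Q y p p f = f" by (rule ext) (rule Q_refl[OF base])
  with base show ?case by (simp only:)
next
  case (step n)
  have "Q y p (Suc n) f = Q y p n (\<lambda>x. G_at G y n x * kernel_op (M_at M y (Suc n)) f x)"
    by (rule ext) (rule Q_Suc[OF step.prems step.hyps(1)])
  with step.IH[OF GM_Bb[OF step.prems]] show ?case by (simp only:)
qed

text \<open>Both f and c vary in the induction, because the recursion replaces f by G times a kernel
  average, whose lower bound is m * c.\<close>

lemma Q_lower:
  assumes "p \<le> n" "f \<in> Bb" "0 < c" "\<And>x. c \<le> f x"
  shows "\<exists>c'>0. \<forall>x. c' \<le> Q y p n f x"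
  using assms
proof (induction n arbitrary: f c rule: dec_induct)
  case base
  then show ?case by (intro exI[of _ c]) (simp add: Q_refl)
next
  case (step n)
  obtain m where m: "0 < m" "\<And>x. m \<le> G_at G y n x" "\<And>x. G_at G y n x \<le> g * m"
    using G_at_bounds[OF y, of n] by blast
  have c: "c \<le> kernel_op (M_at M y (Suc n)) f x" for x
    unfolding kernel_op_def using step.prems by (intro integral_Pr_ge M_at_Pr)
  have "m * c \<le> G_at G y n x * kernel_op (M_at M y (Suc n)) f x" for x
    using m(1) m(2)[of x] c[of x] step.prems(2) by (intro mult_mono) auto
  then show ?case
    using step.IH[OF GM_Bb[OF step.prems(1)], of "m * c"] m(1) step by (simp add: Q_Suc)
qed

lemma Q1_lower:
  assumes "p \<le> n" shows "\<exists>c>0. \<forall>x. c \<le> Q y p n (\<lambda>_. 1) x"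
  by (rule Q_lower[OF assms Bb_const, of 1]) auto

lemma Q1_pos: "p \<le> n \<Longrightarrow> 0 < Q y p n (\<lambda>_. 1) x"
  using Q1_lower less_le_trans by blast

lemma Q1_integral_pos:
  assumes "p \<le> n" "\<mu> \<in> Pr" shows "0 < (\<integral>x. Q y p n (\<lambda>_. 1) x \<partial>\<mu>)"
proof -
  obtain c where c: "0 < c" "\<And>x. c \<le> Q y p n (\<lambda>_. 1) x" using Q1_lower[OF assms(1)] by blast
  have "c \<le> (\<integral>x. Q y p n (\<lambda>_. 1) x \<partial>\<mu>)"
    by (intro integral_Pr_ge assms Q_Bb Bb_const c)
  then show ?thesis using c(1) by linarith
qed

lemma Q1_Suc: "p \<le> n \<Longrightarrow> Q y p (Suc n) (\<lambda>_. 1) x = Q y p n (G_at G y n) x"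
  by (simp add: Q_Suc kernel_op_const)

lemma Phi_refl[simp]: "\<Phi> y p p \<mu> = \<mu>"
  by (simp add: Phi_def)

lemma Phi_Suc: "p \<le> n \<Longrightarrow> \<Phi> y p (Suc n) \<mu> = Phi_step M G y (Suc n) (\<Phi> y p n \<mu>)"
  by (simp add: Phi_def)

lemma Phi_step_Pr: "\<mu> \<in> Pr \<Longrightarrow> Phi_step M G y n \<mu> \<in> Pr"
  using G_at_bounds[OF y, of "n - 1"] unfolding Phi_step_def
  by (auto intro!: bind_Pr integral_Psi(1) G_at_Bb M_at_kernel y)

lemma Phi_Pr:
  assumes "p \<le> n" "\<mu> \<in> Pr" shows "\<Phi> y p n \<mu> \<in> Pr"
  using assms by (induction n rule: dec_induct) (simp_all add: Phi_Suc Phi_step_Pr)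

lemma integral_G_pos:
  assumes "\<mu> \<in> Pr" shows "0 < (\<integral>x. G_at G y n x \<partial>\<mu>)"
proof -
  obtain m where m: "0 < m" "\<And>x. m \<le> G_at G y n x" "\<And>x. G_at G y n x \<le> g * m"
    using G_at_bounds[OF y, of n] by blast
  then show ?thesis using integral_Pr_ge[OF assms G_at_Bb[OF y, of n], of m] by simp
qed

lemma integral_Phi_step:
  assumes "\<mu> \<in> Pr" "f \<in> Bb"
  shows "(\<integral>x. f x \<partial>Phi_step M G y (Suc n) \<mu>) =
    (\<integral>x. G_at G y n x * kernel_op (M_at M y (Suc n)) f x \<partial>\<mu>) / (\<integral>x. G_at G y n x \<partial>\<mu>)"
proof -
  obtain m where m: "0 < m" "\<And>x. m \<le> G_at G y n x" "\<And>x. G_at G y n x \<le> g * m"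
    using G_at_bounds[OF y, of n] by blast
  note P = integral_Psi[OF assms(1) G_at_Bb[OF y] m(1,2)]
  show ?thesis unfolding Phi_step_def
    using integral_bind_Pr[OF P(1) M_at_kernel[OF y] assms(2)]
      P(2)[OF kernel_op_Bb[OF M_at_kernel[OF y] assms(2)]] by simp
qed

text \<open>The nonlinear flow is a normalised linear one. One step turns numerator and denominator
  into integrals at time n; the induction hypothesis applies to both, and their common normalising
  constant cancels.\<close>

lemma integral_Phi:
  assumes "p \<le> n" "\<mu> \<in> Pr" "f \<in> Bb"
  shows "(\<integral>x. f x \<partial>\<Phi> y p n \<mu>) = (\<integral>x. Q y p n f x \<partial>\<mu>) / (\<integral>x. Q y p n (\<lambda>_. 1) x \<partial>\<mu>)"
  using assms(1,3)
proof (induction n arbitrary: f rule: dec_induct)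
  case base
  then show ?case using integral_Pr_const[OF assms(2), of 1] by (simp add: Q_refl del: lebesgue_integral_const)
next
  case (step n)
  have "(\<integral>x. f x \<partial>\<Phi> y p (Suc n) \<mu>) =
     (\<integral>x. G_at G y n x * kernel_op (M_at M y (Suc n)) f x \<partial>\<Phi> y p n \<mu>) / (\<integral>x. G_at G y n x \<partial>\<Phi> y p n \<mu>)"
    using step by (simp add: Phi_Suc integral_Phi_step Phi_Pr assms(2))
  also have "\<dots> = (\<integral>x. Q y p (Suc n) f x \<partial>\<mu>) / (\<integral>x. Q y p (Suc n) (\<lambda>_. 1) x \<partial>\<mu>)"
    using step Q1_integral_pos[OF step(1) assms(2)]
    by (simp add: step.IH[OF GM_Bb] step.IH[OF G_at_Bb[OF y]] Q_Suc Q1_Suc kernel_op_const)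
  finally show ?case .
qed

lemma integral_Q1_Suc:
  assumes "p \<le> n" "\<mu> \<in> Pr"
  shows "(\<integral>x. Q y p (Suc n) (\<lambda>_. 1) x \<partial>\<mu>) =
    (\<integral>x. Q y p n (\<lambda>_. 1) x \<partial>\<mu>) * (\<integral>x. G_at G y n x \<partial>\<Phi> y p n \<mu>)"
  using Q1_integral_pos[OF assms] by (simp add: Q1_Suc assms integral_Phi[OF assms G_at_Bb[OF y]])

lemma ln_integral_Q1:
  assumes "p \<le> n" "\<mu> \<in> Pr"
  shows "ln (\<integral>x. Q y p n (\<lambda>_. 1) x \<partial>\<mu>) = (\<Sum>q\<in>{p..<n}. ln (\<integral>x. G_at G y q x \<partial>\<Phi> y p q \<mu>))"
  using assms(1)
proof (induction n rule: dec_induct)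
  case base
  show ?case using integral_Pr_const[OF assms(2), of 1] by (simp add: Q_refl del: lebesgue_integral_const)
next
  case (step n)
  have "ln (\<integral>x. Q y p (Suc n) (\<lambda>_. 1) x \<partial>\<mu>) =
      ln (\<integral>x. Q y p n (\<lambda>_. 1) x \<partial>\<mu>) + ln (\<integral>x. G_at G y n x \<partial>\<Phi> y p n \<mu>)"
    using Q1_integral_pos[OF step(1) assms(2)] integral_G_pos[OF Phi_Pr[OF step(1) assms(2)], of n]
    by (simp add: integral_Q1_Suc[OF step(1) assms(2)] ln_mult)
  then show ?case using step by simp
qed

lemma Phi_contraction:
  assumes "p \<le> n" "\<mu> \<in> Pr" "\<nu> \<in> Pr"
  shows "tv_le (\<Phi> y p n \<mu>) (\<Phi> y p n \<nu>) (a * r ^ (n - p))"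
  unfolding tv_le_def
proof
  fix f :: "'e \<Rightarrow> real" assume f: "f \<in> Osc"
  let ?d = "a * r ^ (n - p)" and ?u = "Q y p n (\<lambda>_. 1)"
  have osc: "\<bar>P_op M G y p n f x - P_op M G y p n f z\<bar> \<le> ?d" for x z
  proof -
    have "ereal \<bar>P_op M G y p n f x - P_op M G y p n f z\<bar> \<le> dobrushin (P_op M G y p n)"
      unfolding dobrushin_def using f by (meson SUP_upper2 UNIV_I order_refl)
    also have "\<dots> \<le> ereal ?d" by (rule dobrushin_P[OF y assms(1)])
    finally show ?thesis by simp
  qed
  note f' = Osc_Bb[OF f]
  note Qf = Q_Bb[OF assms(1) f'] and Q1 = Q_Bb[OF assms(1) Bb_const[of 1]]
  \<comment> \<open>The tilted measure is not formed. Pointwise comparison of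
    \<open>Q y p n f\<close> with a multiple of \<open>Q y p n (\<lambda>_. 1)\<close> is integrated
    against \<mu> with z fixed, and then over z against \<nu>.\<close>
  have one_sided: "(\<integral>x. f x \<partial>\<Phi> y p n \<mu>) \<le> (\<integral>x. f x \<partial>\<Phi> y p n \<nu>) + ?d"
    if \<mu>: "\<mu> \<in> Pr" and \<nu>: "\<nu> \<in> Pr" for \<mu> \<nu>
  proof -
    have 1: "(\<integral>x. f x \<partial>\<Phi> y p n \<mu>) \<le> P_op M G y p n f z + ?d" for z
    proof -
      let ?c = "P_op M G y p n f z + ?d"
      have "Q y p n f x \<le> ?c * ?u x" for x
      proof -
        have "P_op M G y p n f x \<le> ?c" using osc[of x z] by simp
        then show ?thesis using Q1_pos[OF assms(1), of x] by (simp add: P_op_def field_simps)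
      qed
      then have "(\<integral>x. Q y p n f x \<partial>\<mu>) \<le> (\<integral>x. ?c * ?u x \<partial>\<mu>)"
        using Q1 Qf by (intro integral_Pr_mono \<mu>) auto
      then show ?thesis
        using Q1_integral_pos[OF assms(1) \<mu>] by (simp add: integral_Phi[OF assms(1) \<mu> f'] divide_le_eq)
    qed
    let ?c = "(\<integral>x. f x \<partial>\<Phi> y p n \<mu>) - ?d"
    have "?c * ?u z \<le> Q y p n f z" for z
      using 1[of z] Q1_pos[OF assms(1), of z] by (simp add: P_op_def field_simps)
    then have "(\<integral>z. ?c * ?u z \<partial>\<nu>) \<le> (\<integral>z. Q y p n f z \<partial>\<nu>)"
      using Q1 Qf by (intro integral_Pr_mono \<nu>) auto
    then have "?c \<le> (\<integral>x. f x \<partial>\<Phi> y p n \<nu>)"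
      using Q1_integral_pos[OF assms(1) \<nu>] by (simp add: integral_Phi[OF assms(1) \<nu> f'] le_divide_eq)
    then show ?thesis by simp
  qed
  show "\<bar>(\<integral>x. f x \<partial>\<Phi> y p n \<mu>) - (\<integral>x. f x \<partial>\<Phi> y p n \<nu>)\<bar> \<le> ?d"
    using one_sided[OF assms(2,3)] one_sided[OF assms(3,2)] by linarith
qed

end

end

section \<open>The limiting flow and the function h\<close>

lemma tv_le_tendsto:
  assumes "\<And>n. \<mu> n \<in> Pr" "\<nu> \<in> Pr" "\<And>n. tv_le (\<mu> n) \<nu> (e n)" "e \<longlonglongrightarrow> 0" "f \<in> Bb"
  shows "(\<lambda>n. \<integral>x. f x \<partial>\<mu> n) \<longlonglongrightarrow> (\<integral>x. f x \<partial>\<nu>)"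
proof -
  obtain B where B: "\<And>x. \<bar>f x\<bar> \<le> B" using BbE[OF assms(5)] by blast
  have "\<bar>f x - f z\<bar> \<le> 2 * B" for x z using B[of x] B[of z] by linarith
  then have *: "\<bar>(\<integral>x. f x \<partial>\<mu> n) - (\<integral>x. f x \<partial>\<nu>)\<bar> \<le> 2 * B * e n" for n
    using assms by (intro tv_le_scaled) (auto simp: Bb_measurable)
  have "(\<lambda>n. (\<integral>x. f x \<partial>\<mu> n) - (\<integral>x. f x \<partial>\<nu>)) \<longlonglongrightarrow> 0"
    by (rule Lim_null_comparison[of _ "\<lambda>n. 2 * B * e n"])
       (use * tendsto_mult_right_zero[OF assms(4), of "2 * B"] in auto)
  then show ?thesis by (simp add: LIM_zero_iff)
qed

context fk_env
begin

section \<open>Shift covariance and the pullback flow\<close>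

lemma G_at_shift: "G_at G (env_shift (int k) y) n = G_at G y (n + k)"
  by (simp add: G_at_def env_shift_def)

text \<open>Stated at \<open>Suc n\<close> since a step reads the potential one time earlier; at 0
  the truncated subtraction does not commute with the shift.\<close>

lemma Phi_step_shift: "Phi_step M G (env_shift (int k) y) (Suc n) = Phi_step M G y (Suc n + k)"
  by (rule ext) (simp add: Phi_step_def G_at_def M_at_def env_shift_def algebra_simps)

lemma Phi_shift:
  assumes "y \<in> Env" "p \<le> n"
  shows "\<Phi> (env_shift (int k) y) p n \<mu> = \<Phi> y (p + k) (n + k) \<mu>"
  using assms(2)
  by (induction n rule: dec_induct)
     (simp_all add: Phi_refl Phi_Suc Phi_step_shift assms(1) env_shift_in_space)

lemma Phi_trans:
  assumes "y \<in> Env" "p \<le> q" "q \<le> n"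
  shows "\<Phi> y q n (\<Phi> y p q \<mu>) = \<Phi> y p n \<mu>"
  using assms(3) by (induction n rule: dec_induct) (use assms(1,2) in \<open>simp_all add: Phi_refl Phi_Suc\<close>)

text \<open>The pullback flow: the law at time 0 in the environment y when \<mu> is put in at time -
  n.\<close>

abbreviation past :: "(int \<Rightarrow> 's) \<Rightarrow> nat \<Rightarrow> 'e measure \<Rightarrow> 'e measure" where
  "past y n \<mu> \<equiv> \<Phi> (env_shift (- int n) y) 0 n \<mu>"

lemma past_Pr: "y \<in> Env \<Longrightarrow> \<mu> \<in> Pr \<Longrightarrow> past y n \<mu> \<in> Pr"
  by (simp add: Phi_Pr env_shift_in_space)

lemma past_add:
  assumes y: "y \<in> Env"
  shows "past y (n + k) \<mu> = \<Phi> (env_shift (- int n) y) 0 n (\<Phi> (env_shift (- int (n + k)) y) 0 k \<mu>)"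
proof -
  let ?z = "env_shift (- int (n + k)) y"
  have z: "?z \<in> Env" using y by (rule env_shift_in_space)
  have "\<Phi> (env_shift (int k) ?z) 0 n = \<Phi> ?z (0 + k) (n + k)"
    using Phi_shift[OF z, of 0 n k] by auto
  moreover have "env_shift (int k) ?z = env_shift (- int n) y"
    by (simp add: env_shift_env_shift)
  ultimately show ?thesis using Phi_trans[OF z, of 0 k "n + k" \<mu>] by simp
qed

lemma flow_past:
  assumes y: "y \<in> Env"
  shows "\<Phi> y 0 n (past y k \<mu>) = past (env_shift (int n) y) (n + k) \<mu>"
  using past_add[OF env_shift_in_space[OF y, of "int n"], of n k \<mu>]
  by (simp add: env_shift_env_shift)

text \<open>The longer run is the same last n steps applied to another starting measure, so
  contraction over those n steps compares the two.\<close>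

lemma past_contraction:
  assumes "y \<in> Env" "\<mu> \<in> Pr" "\<nu> \<in> Pr" "n \<le> m"
  shows "tv_le (past y n \<mu>) (past y m \<nu>) (a * r ^ n)"
proof -
  obtain k where m: "m = n + k" using assms(4) le_Suc_ex by blast
  show ?thesis unfolding m past_add[OF assms(1)]
    using Phi_contraction[of "env_shift (- int n) y" 0 n \<mu> "\<Phi> (env_shift (- int (n + k)) y) 0 k \<nu>"]
    by (simp add: assms Phi_Pr env_shift_in_space)
qed

lemma geometric_tendsto_0: "(\<lambda>n. a * r ^ n) \<longlonglongrightarrow> 0"
  using r by (intro tendsto_mult_right_zero LIMSEQ_power_zero) auto

text \<open>The limit is built from one arbitrary Dirac start and attracts every other start by
  letting the longer run grow in the contraction estimate. Total variation convergence implies weak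
  convergence and weak limits are unique, so the definite description denotes the constructed
  measure.\<close>

lemma eta_inf_properties:
  assumes y: "y \<in> Env"
  shows "eta_inf M G y \<in> Pr"
    and "\<And>\<mu> n. \<mu> \<in> Pr \<Longrightarrow> tv_le (past y n \<mu>) (eta_inf M G y) (a * r ^ n)"
proof -
  define \<mu>0 where "\<mu>0 = return borel (undefined :: 'e)"
  have \<mu>0: "\<mu>0 \<in> Pr" by (simp add: \<mu>0_def return_Pr)
  obtain \<nu> where \<nu>: "\<nu> \<in> Pr" and tv0: "\<And>n. tv_le (past y n \<mu>0) \<nu> (a * r ^ n)"
    using tv_Cauchy_limit[OF past_Pr[OF y \<mu>0] past_contraction[OF y \<mu>0 \<mu>0] geometric_tendsto_0] by blast
  have tv: "tv_le (past y n \<mu>) \<nu> (a * r ^ n)" if \<mu>: "\<mu> \<in> Pr" for \<mu> n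
    unfolding tv_le_def
  proof
    fix f :: "'e \<Rightarrow> real" assume f: "f \<in> Osc"
    have "(\<lambda>m. \<integral>x. f x \<partial>past y m \<mu>0) \<longlonglongrightarrow> (\<integral>x. f x \<partial>\<nu>)"
      by (rule tv_le_tendsto[OF past_Pr[OF y \<mu>0] \<nu> tv0 geometric_tendsto_0 Osc_Bb[OF f]])
    then have "(\<lambda>m. \<bar>(\<integral>x. f x \<partial>past y n \<mu>) - (\<integral>x. f x \<partial>past y m \<mu>0)\<bar>)
        \<longlonglongrightarrow> \<bar>(\<integral>x. f x \<partial>past y n \<mu>) - (\<integral>x. f x \<partial>\<nu>)\<bar>"
      by (intro tendsto_intros)
    then show "\<bar>(\<integral>x. f x \<partial>past y n \<mu>) - (\<integral>x. f x \<partial>\<nu>)\<bar> \<le> a * r ^ n"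
      by (rule LIMSEQ_le_const2) (use tv_leD[OF past_contraction[OF y \<mu> \<mu>0] f] in blast)
  qed
  have weak: "weakly_converges (\<lambda>n. past y n \<mu>) \<nu>" if "\<mu> \<in> Pr" for \<mu>
    unfolding weakly_converges_def
    using tv_le_tendsto[OF past_Pr[OF y that] \<nu> tv[OF that] geometric_tendsto_0]
    by (auto simp: Bb_def borel_measurable_continuous_onI)
  have "eta_inf M G y = \<nu>"
    unfolding eta_inf_def
  proof (rule the_equality)
    fix \<nu>' assume \<nu>': "\<nu>' \<in> Pr \<and> (\<forall>\<mu>\<in>Pr. weakly_converges (\<lambda>n. past y n \<mu>) \<nu>')"
    show "\<nu>' = \<nu>"
    proof (rule Pr_eqI_continuous)
      fix f :: "'e \<Rightarrow> real" assume "continuous_on UNIV f" "bounded (range f)"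
      then show "(\<integral>x. f x \<partial>\<nu>') = (\<integral>x. f x \<partial>\<nu>)"
        using LIMSEQ_unique \<nu>' weak \<mu>0 unfolding weakly_converges_def by blast
    qed (use \<nu> \<nu>' in auto)
  qed (use \<nu> weak in auto)
  then show "eta_inf M G y \<in> Pr"
    and "\<And>\<mu> n. \<mu> \<in> Pr \<Longrightarrow> tv_le (past y n \<mu>) (eta_inf M G y) (a * r ^ n)"
    using \<nu> tv by auto
qed

text \<open>Running n steps after a pullback of length k gives a pullback of length n + k in the
  shifted environment. For fixed n the flow is a quotient of integrals of bounded functions, so k
  may tend to infinity on both sides.\<close>

lemma Phi_eta_inf:
  assumes y: "y \<in> Env"
  shows "\<Phi> y 0 n (eta_inf M G y) = eta_inf M G (env_shift (int n) y)"
proof (rule Pr_eqI_continuous)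
  let ?\<mu> = "return borel (undefined :: 'e)" and ?y = "env_shift (int n) y"
  have y': "?y \<in> Env" using y by (rule env_shift_in_space)
  note E = eta_inf_properties[OF y] and E' = eta_inf_properties[OF y']
  show "\<Phi> y 0 n (eta_inf M G y) \<in> Pr" "eta_inf M G ?y \<in> Pr"
    using Phi_Pr[OF y _ E(1)] E'(1) by auto
  fix f :: "'e \<Rightarrow> real" assume "continuous_on UNIV f" "bounded (range f)"
  then have f: "f \<in> Bb" by (simp add: Bb_def borel_measurable_continuous_onI)
  have P: "past y k ?\<mu> \<in> Pr" "past ?y k ?\<mu> \<in> Pr" for k using y y' return_Pr past_Pr by auto
  have lim: "(\<lambda>k. \<integral>x. u x \<partial>past y k ?\<mu>) \<longlonglongrightarrow> (\<integral>x. u x \<partial>eta_inf M G y)" if "u \<in> Bb" for u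
    by (rule tv_le_tendsto[OF P(1) E(1) E(2)[OF return_Pr] geometric_tendsto_0 that])
  have "(\<lambda>k. \<integral>x. f x \<partial>\<Phi> y 0 n (past y k ?\<mu>)) \<longlonglongrightarrow> (\<integral>x. f x \<partial>\<Phi> y 0 n (eta_inf M G y))"
    unfolding integral_Phi[OF y le0 P(1) f] integral_Phi[OF y le0 E(1) f]
    using Q1_integral_pos[OF y le0 E(1), of n] Q_Bb[OF y le0] f by (intro tendsto_divide lim) auto
  moreover have "(\<lambda>k. \<integral>x. f x \<partial>past ?y (n + k) ?\<mu>) \<longlonglongrightarrow> (\<integral>x. f x \<partial>eta_inf M G ?y)"
    using LIMSEQ_ignore_initial_segment[OF
        tv_le_tendsto[OF P(2) E'(1) E'(2)[OF return_Pr] geometric_tendsto_0 f], of n]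
    by (simp add: add.commute)
  ultimately show "(\<integral>x. f x \<partial>\<Phi> y 0 n (eta_inf M G y)) = (\<integral>x. f x \<partial>eta_inf M G ?y)"
    unfolding flow_past[OF y] by (rule LIMSEQ_unique)
qed

lemma Phi_tv_eta_inf:
  assumes "y \<in> Env" "\<mu> \<in> Pr"
  shows "tv_le (\<Phi> y 0 n \<mu>) (eta_inf M G (env_shift (int n) y)) (a * r ^ n)"
  using eta_inf_properties(2)[OF env_shift_in_space[OF assms(1)] assms(2), of n "int n"]
  by (simp add: env_shift_env_shift)

text \<open>G has oscillation at most g * m, and ln is Lipschitz with constant 1 / m above m. The
  environment-dependent m cancels.\<close>

lemma ln_G_diff:
  assumes y: "y \<in> Env" and \<mu>: "\<mu> \<in> Pr" and \<nu>: "\<nu> \<in> Pr" and tv: "tv_le \<mu> \<nu> d"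
  shows "\<bar>ln (\<integral>x. G_at G y n x \<partial>\<mu>) - ln (\<integral>x. G_at G y n x \<partial>\<nu>)\<bar> \<le> g * d"
proof -
  obtain m where m: "0 < m" "\<And>x. m \<le> G_at G y n x" "\<And>x. G_at G y n x \<le> g * m"
    using G_at_bounds[OF y, of n] by blast
  define A B where "A = (\<integral>x. G_at G y n x \<partial>\<mu>)" and "B = (\<integral>x. G_at G y n x \<partial>\<nu>)"
  have AB: "m \<le> A" "m \<le> B" unfolding A_def B_def
    using m \<mu> \<nu> G_at_Bb[OF y] by (auto intro!: integral_Pr_ge)
  have "\<bar>G_at G y n x - G_at G y n z\<bar> \<le> g * m" for x z using m(1) m(2,3)[of x] m(2,3)[of z] by linarith
  then have d: "\<bar>A - B\<bar> \<le> g * m * d" unfolding A_def B_def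
    by (intro tv_le_scaled[OF tv \<mu> \<nu>]) (auto simp: Bb_measurable G_at_Bb y)
  have one_sided: "ln u - ln v \<le> g * d" if "m \<le> u" "m \<le> v" "\<bar>u - v\<bar> \<le> g * m * d" for u v
  proof -
    have "ln u - ln v \<le> (u - v) / v" using that m(1) by (intro ln_diff_le) auto
    also have "\<dots> \<le> \<bar>u - v\<bar> / m" using that m(1) by (intro frac_le) auto
    also have "\<dots> \<le> g * m * d / m" using that m(1) by (intro divide_right_mono) auto
    finally show ?thesis using m(1) by simp
  qed
  show ?thesis unfolding A_def[symmetric] B_def[symmetric]
    using one_sided[OF AB d] one_sided[OF AB(2,1)] d by (simp add: abs_minus_commute abs_le_iff)
qed

text \<open>The common form of the summands of ln h (p = 0, \<mu> the limiting measure) and of the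
  logarithm of the normalised semigroup (\<mu> the flow at time p).\<close>

definition log_ratio :: "(int \<Rightarrow> 's) \<Rightarrow> nat \<Rightarrow> nat \<Rightarrow> 'e measure \<Rightarrow> 'e \<Rightarrow> real" where
  "log_ratio y p q \<mu> x =
     ln (\<integral>z. G_at G y q z \<partial>\<Phi> y p q (return borel x)) - ln (\<integral>z. G_at G y q z \<partial>\<Phi> y p q \<mu>)"

lemma log_ratio_bound:
  assumes "y \<in> Env" "p \<le> q" "\<mu> \<in> Pr"
  shows "\<bar>log_ratio y p q \<mu> x\<bar> \<le> g * a * r ^ (q - p)"
  using ln_G_diff[OF assms(1) Phi_Pr Phi_Pr Phi_contraction, OF assms(1,2) _ assms(1,2,3) assms(1,2) _ assms(3), of "return borel x"]
  by (simp add: log_ratio_def return_Pr mult.assoc)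

lemma log_ratio_shift:
  "y \<in> Env \<Longrightarrow> log_ratio (env_shift (int p) y) 0 q \<mu> x = log_ratio y p (q + p) \<mu> x"
  by (simp add: log_ratio_def G_at_shift Phi_shift)

text \<open>At a Dirac start \<open>integral_Phi\<close> gives a quotient of two functions of x
  known to be measurable, so the flow need not be treated as a measure-valued function of x.\<close>

lemma log_ratio_measurable:
  assumes "y \<in> Env" "p \<le> q" shows "log_ratio y p q \<mu> \<in> borel_measurable borel"
proof -
  have "(\<integral>z. G_at G y q z \<partial>\<Phi> y p q (return borel x)) = Q y p q (G_at G y q) x / Q y p q (\<lambda>_. 1) x" for x
    using assms by (simp add: integral_Phi return_Pr G_at_Bb integral_return_Bb Q_Bb)
  moreover have [measurable]: "Q y p q (G_at G y q) \<in> borel_measurable borel" "Q y p q (\<lambda>_. 1) \<in> borel_measurable borel"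
    using assms by (auto intro!: Bb_measurable Q_Bb G_at_Bb)
  ultimately show ?thesis unfolding log_ratio_def[abs_def] by simp
qed

text \<open>The Dirac terms cancel, and both reference flows are rewritten as flows from time 0.
  This yields r ^ q, whose sum over q \<ge> p is of order r ^ p.\<close>

lemma log_ratio_diff_bound:
  assumes y: "y \<in> Env" and "p \<le> q" "\<mu> \<in> Pr"
  shows "\<bar>log_ratio y p q (\<Phi> y 0 p \<mu>) x - log_ratio y p q (eta_inf M G (env_shift (int p) y)) x\<bar> \<le> g * a * r ^ q"
proof -
  have E: "eta_inf M G y \<in> Pr" using eta_inf_properties(1)[OF y] .
  have "\<bar>ln (\<integral>z. G_at G y q z \<partial>\<Phi> y 0 q \<mu>) - ln (\<integral>z. G_at G y q z \<partial>\<Phi> y 0 q (eta_inf M G y))\<bar> \<le> g * (a * r ^ (q - 0))"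
    by (intro ln_G_diff y Phi_Pr Phi_contraction E assms) auto
  then show ?thesis
    unfolding log_ratio_def Phi_eta_inf[OF y, symmetric] using assms Phi_trans[OF y _ assms(2)] by simp
qed

lemma h_fun_eq: "h_fun M G y x = exp (\<Sum>q. log_ratio y 0 q (eta_inf M G y) x)"
  by (simp add: h_fun_def log_ratio_def)

lemma h_fun_measurable:
  assumes "y \<in> Env" shows "h_fun M G y \<in> borel_measurable borel"
proof -
  note [measurable] = log_ratio_measurable[OF assms le0]
  show ?thesis unfolding h_fun_eq[abs_def] by measurable
qed

lemma Q_bar_eq:
  assumes y: "y \<in> Env" and pn: "p \<le> n" and \<mu>: "eta M G \<eta> y (int p) \<in> Pr"
  shows "Q_bar M G \<eta> y p n (\<lambda>_. 1) x = exp (\<Sum>j<n - p. log_ratio y p (j + p) (eta M G \<eta> y (int p)) x)"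
proof -
  let ?\<mu> = "eta M G \<eta> y (int p)"
  \<comment> \<open>The value at x becomes an integral against the Dirac mass at x, so that
    \<open>ln_integral_Q1\<close> expands numerator and denominator alike.\<close>
  have "ln (Q_bar M G \<eta> y p n (\<lambda>_. 1) x) =
    ln (\<integral>x. Q y p n (\<lambda>_. 1) x \<partial>return borel x) - ln (\<integral>x. Q y p n (\<lambda>_. 1) x \<partial>?\<mu>)"
    unfolding Q_bar_def using Q1_pos[OF y pn, of x] Q1_integral_pos[OF y pn \<mu>]
    by (simp add: ln_div integral_return_Bb Q_Bb y pn)
  also have "\<dots> = (\<Sum>q\<in>{p..<n}. log_ratio y p q ?\<mu> x)"
    by (simp add: ln_integral_Q1 y pn \<mu> return_Pr log_ratio_def sum_subtractf)
  also have "\<dots> = (\<Sum>j<n - p. log_ratio y p (j + p) ?\<mu> x)"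
    using pn by (intro sum.reindex_bij_witness[of _ "\<lambda>j. j + p" "\<lambda>q. q - p"]) auto
  finally have "ln (Q_bar M G \<eta> y p n (\<lambda>_. 1) x) = \<dots>" .
  moreover have "0 < Q_bar M G \<eta> y p n (\<lambda>_. 1) x"
    unfolding Q_bar_def using Q1_pos[OF y pn] Q1_integral_pos[OF y pn \<mu>] by simp
  ultimately show ?thesis by (metis exp_ln)
qed

end

section \<open>Local covariances\<close>

lemma tv_le_nonneg: "tv_le \<mu> \<nu> d \<Longrightarrow> 0 \<le> d"
  using tv_leD[of \<mu> \<nu> d "\<lambda>_. 0"] by (simp add: OscI)

text \<open>Factoring out the larger exponential, at most exp D, leaves 1 - exp (- t) \<le>
  t.\<close>

lemma abs_exp_diff_le:
  fixes u v D :: real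
  assumes "u \<le> D" "v \<le> D"
  shows "\<bar>exp u - exp v\<bar> \<le> exp D * \<bar>u - v\<bar>"
proof -
  have *: "exp v - exp u \<le> exp D * (v - u)" if "u \<le> v" "v \<le> D" for u v :: real
  proof -
    have "exp v - exp u = exp v * (1 - exp (u - v))" by (simp add: exp_diff algebra_simps)
    also have "\<dots> \<le> exp D * (v - u)"
    proof (intro mult_mono)
      show "1 - exp (u - v) \<le> v - u" using exp_ge_add_one_self[of "u - v"] by linarith
    qed (use that in auto)
    finally show ?thesis .
  qed
  show ?thesis using *[of u v] *[of v u] assms by (cases "u \<le> v") auto
qed

text \<open>The offset k is 0 for uniform bounds, n - p for the tail of the series of ln h, and p
  for the change of reference measure.\<close>

lemma geometric_dominated:
  fixes F :: "nat \<Rightarrow> real"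
  assumes r: "0 < r" "r < 1" and F: "\<And>j. \<bar>F j\<bar> \<le> c * r ^ (j + k)"
  shows "summable F" "\<bar>suminf F\<bar> \<le> c / (1 - r) * r ^ k" "\<bar>sum F {..<N}\<bar> \<le> c / (1 - r) * r ^ k"
proof -
  have s: "(\<lambda>j. c * r ^ (j + k)) sums (c / (1 - r) * r ^ k)"
    using sums_mult[OF geometric_sums[of r], of "c * r ^ k"] r by (simp add: power_add mult_ac)
  have abs_s: "summable (\<lambda>j. \<bar>F j\<bar>)"
    by (rule summable_comparison_test'[OF sums_summable[OF s], of 0]) (use F in auto)
  then show "summable F" by (rule summable_rabs_cancel)
  have le: "(\<Sum>j. \<bar>F j\<bar>) \<le> c / (1 - r) * r ^ k"
    using suminf_le[OF F abs_s sums_summable[OF s]] sums_unique[OF s] by simp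
  show "\<bar>suminf F\<bar> \<le> c / (1 - r) * r ^ k"
    using summable_rabs[OF abs_s] le by linarith
  have "\<bar>sum F {..<N}\<bar> \<le> (\<Sum>j<N. \<bar>F j\<bar>)" by (rule sum_abs)
  also have "\<dots> \<le> (\<Sum>j. \<bar>F j\<bar>)" by (rule sum_le_suminf[OF abs_s]) auto
  finally show "\<bar>sum F {..<N}\<bar> \<le> c / (1 - r) * r ^ k" using le by linarith
qed

text \<open>Distinct exponents make the sum part of the full geometric series. One bound,
  independent of the index set, serves the exponents p, n - p and p - 1.\<close>

lemma sum_power_inj_le:
  fixes r :: real
  assumes "0 < r" "r < 1" "finite A" "inj_on f A"
  shows "(\<Sum>p\<in>A. r ^ f p) \<le> 1 / (1 - r)"
proof -
  have "(\<Sum>p\<in>A. r ^ f p) = (\<Sum>j\<in>f ` A. r ^ j)" using assms by (simp add: sum.reindex)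
  also have "\<dots> \<le> (\<Sum>j. r ^ j)"
    using assms by (intro sum_le_suminf) (auto intro: summable_geometric)
  also have "\<dots> = 1 / (1 - r)" using assms by (simp add: suminf_geometric)
  finally show ?thesis .
qed

text \<open>The variance of f under \<open>N x\<close>, which is the integrand of \<open>Cov\<close>
  when its two functions coincide.\<close>

definition kernel_var :: "('e \<Rightarrow> 'e measure) \<Rightarrow> ('e \<Rightarrow> real) \<Rightarrow> 'e \<Rightarrow> real" where
  "kernel_var N f x = kernel_op N (\<lambda>x'. f x' * f x') x - kernel_op N f x * kernel_op N f x"

lemma Cov_eq_kernel_var: "Cov K \<eta> y n \<mu> f f = (\<integral>x. kernel_var (K_at K \<eta> y n \<mu>) f x \<partial>\<mu>)"
  by (simp add: Cov_def kernel_var_def)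

lemma kernel_op_abs_le:
  assumes "N x \<in> Pr" "f \<in> Bb" "\<And>x. \<bar>f x\<bar> \<le> B" shows "\<bar>kernel_op N f x\<bar> \<le> B"
proof -
  have "f x \<le> B" "- B \<le> f x" for x using assms(3)[of x] by linarith+
  then have "kernel_op N f x \<le> B" "- B \<le> kernel_op N f x"
    unfolding kernel_op_def using assms by (auto intro!: integral_Pr_le integral_Pr_ge)
  then show ?thesis by linarith
qed

lemma abs_square_le:
  fixes u B :: real
  assumes "\<bar>u\<bar> \<le> B" shows "0 \<le> u * u" "u * u \<le> B * B"
  using mult_mono[of "\<bar>u\<bar>" B "\<bar>u\<bar>" B] assms by (auto simp: abs_mult_self_eq)

text \<open>A difference of two numbers in [0, B * B]; no Jensen inequality is involved.\<close>

lemma kernel_var_bounds: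
  assumes N: "N x \<in> Pr" and f: "f \<in> Bb" and B: "\<And>x. \<bar>f x\<bar> \<le> B"
  shows "\<bar>kernel_var N f x\<bar> \<le> B * B"
proof -
  have "0 \<le> kernel_op N (\<lambda>x'. f x' * f x') x" "kernel_op N (\<lambda>x'. f x' * f x') x \<le> B * B"
    unfolding kernel_op_def using abs_square_le[OF B]
    by (auto intro!: integral_Pr_le integral_Pr_ge N Bb_mult f)
  moreover note abs_square_le[OF kernel_op_abs_le[where N=N and x=x, OF N f B]]
  ultimately show ?thesis unfolding kernel_var_def by linarith
qed

lemma kernel_var_Bb:
  assumes "N \<in> borel \<rightarrow>\<^sub>M prob_algebra borel" "f \<in> Bb"
  shows "kernel_var N f \<in> Bb"
  unfolding kernel_var_def[abs_def] by (intro Bb_diff Bb_mult kernel_op_Bb assms)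

lemma integral_kernel_var_le:
  assumes N: "N \<in> borel \<rightarrow>\<^sub>M prob_algebra borel" and \<mu>: "\<mu> \<in> Pr" and f: "f \<in> Bb" and B: "\<And>x. \<bar>f x\<bar> \<le> B"
  shows "\<bar>\<integral>x. kernel_var N f x \<partial>\<mu>\<bar> \<le> B * B"
proof -
  have Nx: "N x \<in> Pr" for x using measurable_space[OF N, of x] by simp
  have "\<bar>kernel_op (\<lambda>_. \<mu>) (kernel_var N f) undefined\<bar> \<le> B * B"
    by (rule kernel_op_abs_le[OF \<mu> kernel_var_Bb[OF N f] kernel_var_bounds[OF Nx f B]])
  then show ?thesis by (simp add: kernel_op_def)
qed

text \<open>Function, kernel and measure are exchanged in turn. The function costs 2 * B * e in each
  of the two terms of the variance. The kernel costs B * B through the mean of the square and 4 * (B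
  * B) through the squared mean, times \<kappa> * d. The measure costs the oscillation 2 * (B * B)
  of the variance, times d.\<close>

lemma integral_kernel_var_diff:
  assumes N1: "N1 \<in> borel \<rightarrow>\<^sub>M prob_algebra borel" and N2: "N2 \<in> borel \<rightarrow>\<^sub>M prob_algebra borel"
    and \<mu>: "\<mu>1 \<in> Pr" "\<mu>2 \<in> Pr" and f: "f1 \<in> Bb" "f2 \<in> Bb"
    and B: "\<And>x. \<bar>f1 x\<bar> \<le> B" "\<And>x. \<bar>f2 x\<bar> \<le> B" and e: "\<And>x. \<bar>f1 x - f2 x\<bar> \<le> e"
    and lip: "\<And>x. tv_le (N1 x) (N2 x) (\<kappa> * d)" and tv: "tv_le \<mu>1 \<mu>2 d"
  shows "\<bar>(\<integral>x. kernel_var N1 f1 x \<partial>\<mu>1) - (\<integral>x. kernel_var N2 f2 x \<partial>\<mu>2)\<bar> \<le> 4 * B * e + (5 * \<kappa> + 2) * (B * B) * d"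
proof -
  have P1: "N1 x \<in> Pr" and P2: "N2 x \<in> Pr" for x
    using measurable_space[OF N1, of x] measurable_space[OF N2, of x] by auto
  have B0: "0 \<le> B" using B(1)[of undefined] by linarith
  have pointwise: "\<bar>kernel_var N1 f1 x - kernel_var N2 f2 x\<bar> \<le> 4 * B * e + 5 * \<kappa> * (B * B) * d" for x
  proof -
    have sq: "\<bar>u * u - v * v\<bar> \<le> 2 * B * c" if "\<bar>u\<bar> \<le> B" "\<bar>v\<bar> \<le> B" "\<bar>u - v\<bar> \<le> c" for u v c
    proof -
      have "\<bar>u * u - v * v\<bar> = \<bar>u + v\<bar> * \<bar>u - v\<bar>" by (simp add: abs_mult[symmetric] algebra_simps)
      also have "\<dots> \<le> (2 * B) * c" using that B0 by (intro mult_mono) auto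
      finally show ?thesis .
    qed
    have "\<bar>kernel_op N1 (\<lambda>x. f1 x * f1 x) x - kernel_op N1 (\<lambda>x. f2 x * f2 x) x\<bar> \<le> 2 * B * e"
      unfolding kernel_op_def by (intro integral_Pr_abs_diff_le P1 Bb_mult f sq B e)
    moreover have "\<bar>kernel_op N1 (\<lambda>x. f2 x * f2 x) x - kernel_op N2 (\<lambda>x. f2 x * f2 x) x\<bar> \<le> (B * B) * (\<kappa> * d)"
      unfolding kernel_op_def
    proof (rule tv_le_scaled[OF lip P1 P2])
      show "\<bar>f2 x * f2 x - f2 z * f2 z\<bar> \<le> B * B" for x z
        using abs_square_le[OF B(2), of x] abs_square_le[OF B(2), of z] by linarith
    qed (rule Bb_measurable[OF Bb_mult[OF f(2) f(2)]])
    moreover have "\<bar>kernel_op N1 f1 x - kernel_op N2 f2 x\<bar> \<le> e + (2 * B) * (\<kappa> * d)"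
    proof -
      have "\<bar>kernel_op N1 f1 x - kernel_op N1 f2 x\<bar> \<le> e"
        unfolding kernel_op_def by (intro integral_Pr_abs_diff_le P1 f e)
      moreover have "\<bar>kernel_op N1 f2 x - kernel_op N2 f2 x\<bar> \<le> (2 * B) * (\<kappa> * d)"
        unfolding kernel_op_def
      proof (rule tv_le_scaled[OF lip P1 P2 Bb_measurable[OF f(2)]])
        show "\<bar>f2 x - f2 z\<bar> \<le> 2 * B" for x z using B(2)[of x] B(2)[of z] by linarith
      qed
      ultimately show ?thesis by linarith
    qed
    then have "\<bar>kernel_op N1 f1 x * kernel_op N1 f1 x - kernel_op N2 f2 x * kernel_op N2 f2 x\<bar>
        \<le> 2 * B * (e + (2 * B) * (\<kappa> * d))"
      by (intro sq kernel_op_abs_le P1 P2 f B)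
    ultimately have "\<bar>kernel_var N1 f1 x - kernel_var N2 f2 x\<bar>
        \<le> 2 * B * e + (B * B) * (\<kappa> * d) + 2 * B * (e + (2 * B) * (\<kappa> * d))"
      unfolding kernel_var_def by linarith
    also have "\<dots> = 4 * B * e + 5 * \<kappa> * (B * B) * d" by (simp add: algebra_simps)
    finally show ?thesis .
  qed
  have "\<bar>(\<integral>x. kernel_var N1 f1 x \<partial>\<mu>1) - (\<integral>x. kernel_var N2 f2 x \<partial>\<mu>1)\<bar> \<le> 4 * B * e + 5 * \<kappa> * (B * B) * d"
    by (intro integral_Pr_abs_diff_le \<mu> kernel_var_Bb N1 N2 f pointwise)
  moreover have "\<bar>(\<integral>x. kernel_var N2 f2 x \<partial>\<mu>1) - (\<integral>x. kernel_var N2 f2 x \<partial>\<mu>2)\<bar> \<le> (2 * (B * B)) * d"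
  proof (rule tv_le_scaled[OF tv \<mu> Bb_measurable[OF kernel_var_Bb[OF N2 f(2)]]])
    show "\<bar>kernel_var N2 f2 x - kernel_var N2 f2 z\<bar> \<le> 2 * (B * B)" for x z
      using kernel_var_bounds[where N=N2 and x=x, OF P2 f(2) B(2)]
        kernel_var_bounds[where N=N2 and x=z, OF P2 f(2) B(2)] by linarith
  qed
  ultimately show ?thesis by (simp add: algebra_simps)
qed

section \<open>Uniform bounds and the comparison with h\<close>

context fk_env
begin

text \<open>The geometric sum of the bounds on the logarithmic increments: it bounds ln h and the
  logarithm of the normalised semigroup for every environment, point and time.\<close>

abbreviation "D \<equiv> g * a / (1 - r)"

text \<open>No sign is assumed of g or a; it is read off from a bound on an absolute value, once an
  environment exists.\<close>

lemma log_ratio_constant_nonneg: "y \<in> Env \<Longrightarrow> 0 \<le> g * a"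
  using log_ratio_bound[of y 0 0 "return borel undefined" undefined] return_Pr by fastforce

lemma h_fun_bounds:
  assumes "y \<in> Env" shows "0 < h_fun M G y x" "h_fun M G y x \<le> exp D"
proof -
  have "\<bar>\<Sum>q. log_ratio y 0 q (eta_inf M G y) x\<bar> \<le> D * r ^ 0"
    using log_ratio_bound[OF assms le0 eta_inf_properties(1)[OF assms]]
    by (intro geometric_dominated(2) r) auto
  then show "0 < h_fun M G y x" "h_fun M G y x \<le> exp D" by (auto simp: h_fun_eq)
qed

lemma Q_bar_bounds:
  assumes y: "y \<in> Env" and "\<eta> \<in> Pr" "p \<le> n"
  shows "0 < Q_bar M G \<eta> y p n (\<lambda>_. 1) x" "Q_bar M G \<eta> y p n (\<lambda>_. 1) x \<le> exp D"
proof -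
  have \<mu>: "eta M G \<eta> y (int p) \<in> Pr" by (simp add: eta_def Phi_Pr assms)
  have "\<bar>\<Sum>j<n - p. log_ratio y p (j + p) (eta M G \<eta> y (int p)) x\<bar> \<le> D * r ^ 0"
    using log_ratio_bound[OF y _ \<mu>, of p "_ + p"] by (intro geometric_dominated(3) r) auto
  then show "0 < Q_bar M G \<eta> y p n (\<lambda>_. 1) x" "Q_bar M G \<eta> y p n (\<lambda>_. 1) x \<le> exp D"
    by (auto simp: Q_bar_eq[OF y assms(3) \<mu>])
qed

text \<open>The factor \<open>r ^ (n - p)\<close> comes from truncating the series of \<open>ln h\<close>, and \<open>r ^ p\<close> from
  replacing the limiting flow by the flow started at \<open>\<eta>\<close>.\<close>

lemma Q_bar_h_fun_diff:
  assumes y: "y \<in> Env" and \<eta>: "\<eta> \<in> Pr" and pn: "p \<le> n"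
  shows "\<bar>Q_bar M G \<eta> y p n (\<lambda>_. 1) x - h_fun M G (env_shift (int p) y) x\<bar>
    \<le> exp D * (D * (r ^ p + r ^ (n - p)))"
proof -
  let ?y = "env_shift (int p) y" and ?\<mu> = "eta M G \<eta> y (int p)"
  have y': "?y \<in> Env" using y by (rule env_shift_in_space)
  have \<mu>_eq: "?\<mu> = \<Phi> y 0 p \<eta>" by (simp add: eta_def)
  have \<mu>: "?\<mu> \<in> Pr" by (simp add: \<mu>_eq Phi_Pr y \<eta>)
  define L where "L j = log_ratio y p (j + p) (eta_inf M G ?y) x" for j
  define R where "R j = log_ratio y p (j + p) ?\<mu> x" for j
  note E = eta_inf_properties(1)[OF y']
  have L: "\<bar>L j\<bar> \<le> g * a * r ^ (j + 0)" for j
    unfolding L_def using log_ratio_bound[OF y _ E, of p "j + p"] by simp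
  have R: "\<bar>R j\<bar> \<le> g * a * r ^ (j + 0)" for j
    unfolding R_def using log_ratio_bound[OF y _ \<mu>, of p "j + p"] by simp
  note sumL = geometric_dominated[OF r L]
  have "suminf L = (\<Sum>j. L (j + (n - p))) + sum L {..<n - p}"
    by (rule suminf_split_initial_segment[OF sumL(1)])
  moreover have "\<bar>\<Sum>j. L (j + (n - p))\<bar> \<le> D * r ^ (n - p)"
    using L by (intro geometric_dominated(2)[OF r]) auto
  moreover have "\<bar>\<Sum>j<n - p. R j - L j\<bar> \<le> D * r ^ p"
    using log_ratio_diff_bound[OF y _ \<eta>, of p "_ + p" x]
    by (intro geometric_dominated(3)[OF r]) (auto simp: R_def L_def \<mu>_eq)
  ultimately have diff: "\<bar>sum R {..<n - p} - suminf L\<bar> \<le> D * (r ^ p + r ^ (n - p))"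
    unfolding sum_subtractf distrib_left by linarith
  have h: "h_fun M G ?y x = exp (suminf L)"
    by (simp add: h_fun_eq log_ratio_shift[OF y] L_def[abs_def])
  have q: "Q_bar M G \<eta> y p n (\<lambda>_. 1) x = exp (sum R {..<n - p})"
    by (simp add: Q_bar_eq[OF y pn \<mu>] R_def[abs_def])
  have "\<bar>exp (sum R {..<n - p}) - exp (suminf L)\<bar> \<le> exp D * \<bar>sum R {..<n - p} - suminf L\<bar>"
    using geometric_dominated(3)[OF r R, of "n - p"] sumL(2)
    by (intro abs_exp_diff_le) auto
  also have "\<dots> \<le> exp D * (D * (r ^ p + r ^ (n - p)))"
    using diff by (intro mult_left_mono) auto
  finally show ?thesis unfolding h q .
qed

lemma abs_h_fun_le: "y \<in> Env \<Longrightarrow> \<bar>h_fun M G y x\<bar> \<le> exp D"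
  using h_fun_bounds[of y x] by simp

lemma h_fun_Bb: "y \<in> Env \<Longrightarrow> h_fun M G y \<in> Bb"
  by (rule BbI[OF h_fun_measurable abs_h_fun_le])

lemma Q_bar_Bb:
  assumes "y \<in> Env" "p \<le> n" shows "Q_bar M G \<eta> y p n (\<lambda>_. 1) \<in> Bb"
  unfolding Q_bar_def[abs_def] by (intro Bb_divide_const Q_Bb assms Bb_const)

end

text \<open>Taking the supremum over test functions in the Lipschitz assumption eliminates the
  auxiliary functions T: what remains is that the kernels depend on the measure in a Lipschitz way
  in total variation.\<close>

locale fk_mckean = fk_env S M G g a r
  for S :: "'s measure" and M :: "'s \<Rightarrow> 'e::polish_space \<Rightarrow> 'e measure" and G :: "'s \<Rightarrow> 'e \<Rightarrow> real"
    and g a r :: real +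
  fixes K :: "'s \<times> 's \<Rightarrow> 'e measure \<Rightarrow> 'e \<Rightarrow> 'e measure" and \<eta>\<^sub>0 :: "'e measure" and \<kappa> :: real
  assumes \<eta>\<^sub>0: "\<eta>\<^sub>0 \<in> Pr"
    and K_kernel: "\<And>s s' \<mu>. s \<in> space S \<Longrightarrow> s' \<in> space S \<Longrightarrow> \<mu> \<in> Pr \<Longrightarrow>
           K (s, s') \<mu> \<in> borel \<rightarrow>\<^sub>M prob_algebra borel"
    and \<kappa>: "0 \<le> \<kappa>"
    and K_lipschitz: "\<And>y n \<mu> \<nu> d x. y \<in> space (env_space S) \<Longrightarrow> 1 \<le> n \<Longrightarrow> \<mu> \<in> Pr \<Longrightarrow> \<nu> \<in> Pr \<Longrightarrow> tv_le \<mu> \<nu> d \<Longrightarrow>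
           tv_le (K_at K \<eta>\<^sub>0 y n \<mu> x) (K_at K \<eta>\<^sub>0 y n \<nu> x) (\<kappa> * d)"
begin

lemma K_at_kernel:
  assumes "y \<in> Env" "\<mu> \<in> Pr" shows "K_at K \<eta>\<^sub>0 y n \<mu> \<in> borel \<rightarrow>\<^sub>M prob_algebra borel"
  using assms \<eta>\<^sub>0 by (cases "n = 0") (auto simp: K_at_def K_kernel EnvD)

lemma eta_Pr: "y \<in> Env \<Longrightarrow> eta M G \<eta>\<^sub>0 y k \<in> Pr"
  by (simp add: eta_def \<eta>\<^sub>0 Phi_Pr)

text \<open>Time 1 in the environment shifted by p - 1 is time p in y. This fails at p = 0, where
  \<open>K_at\<close> ignores the environment.\<close>

lemma C_fun_shift:
  assumes "1 \<le> p"
  shows "C_fun M G K \<eta>\<^sub>0 (env_shift (int p) y) =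
    (\<integral>x. kernel_var (K_at K \<eta>\<^sub>0 y p (eta_inf M G (env_shift (int (p - 1)) y)))
      (h_fun M G (env_shift (int p) y)) x \<partial>eta_inf M G (env_shift (int (p - 1)) y))"
proof -
  have "env_shift (- 1) (env_shift (int p) y) = env_shift (int (p - 1)) y"
    using assms by (simp add: env_shift_env_shift of_nat_diff)
  moreover have "K_at K \<eta>\<^sub>0 (env_shift (int (p - 1)) y) 1 = K_at K \<eta>\<^sub>0 y p"
    using assms by (intro ext) (simp add: K_at_def env_shift_def of_nat_diff)
  ultimately show ?thesis unfolding C_fun_def Cov_eq_kernel_var by simp
qed

lemma C_fun_bounded:
  assumes "y \<in> Env" shows "\<bar>C_fun M G K \<eta>\<^sub>0 y\<bar> \<le> exp D * exp D"
proof -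
  have y: "env_shift (- 1) y \<in> Env" using assms by (rule env_shift_in_space)
  note E = eta_inf_properties(1)[OF y]
  show ?thesis unfolding C_fun_def Cov_eq_kernel_var
    by (intro integral_kernel_var_le K_at_kernel y E h_fun_Bb assms abs_h_fun_le)
qed

abbreviation "cov_term y n p \<equiv> Cov K \<eta>\<^sub>0 y p (eta M G \<eta>\<^sub>0 y (int p - 1))
   (Q_bar M G \<eta>\<^sub>0 y p n (\<lambda>_. 1)) (Q_bar M G \<eta>\<^sub>0 y p n (\<lambda>_. 1))"

lemma abs_Q_bar_le: "y \<in> Env \<Longrightarrow> p \<le> n \<Longrightarrow> \<bar>Q_bar M G \<eta>\<^sub>0 y p n (\<lambda>_. 1) x\<bar> \<le> exp D"
  using Q_bar_bounds[OF _ \<eta>\<^sub>0, of y p n x] by simp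

lemma cov_term_bounded:
  assumes "y \<in> Env" "p \<le> n" shows "\<bar>cov_term y n p\<bar> \<le> exp D * exp D"
  unfolding Cov_eq_kernel_var
  by (intro integral_kernel_var_le K_at_kernel assms eta_Pr Q_bar_Bb abs_Q_bar_le)

text \<open>The function is compared at time p, but the measure and the kernel are fed by the flow
  at time p - 1, hence the exponent p - 1 in the last term.\<close>

lemma cov_term_C_fun_diff:
  assumes y: "y \<in> Env" and p: "1 \<le> p" "p \<le> n"
  shows "\<bar>cov_term y n p - C_fun M G K \<eta>\<^sub>0 (env_shift (int p) y)\<bar> \<le>
    4 * exp D * (exp D * (D * (r ^ p + r ^ (n - p)))) + (5 * \<kappa> + 2) * (exp D * exp D) * (a * r ^ (p - 1))"
proof -
  let ?y = "env_shift (int (p - 1)) y"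
  have y': "?y \<in> Env" "env_shift (int p) y \<in> Env" using y by (auto intro: env_shift_in_space)
  note E = eta_inf_properties(1)[OF y'(1)]
  have eta: "eta M G \<eta>\<^sub>0 y (int p - 1) = \<Phi> y 0 (p - 1) \<eta>\<^sub>0"
    using p by (simp add: eta_def nat_diff_distrib)
  have tv: "tv_le (eta M G \<eta>\<^sub>0 y (int p - 1)) (eta_inf M G ?y) (a * r ^ (p - 1))"
    unfolding eta by (rule Phi_tv_eta_inf[OF y \<eta>\<^sub>0])
  show ?thesis
    unfolding C_fun_shift[OF p(1)] Cov_eq_kernel_var
    by (rule integral_kernel_var_diff[OF K_at_kernel[OF y eta_Pr[OF y]] K_at_kernel[OF y E] eta_Pr[OF y] E
          Q_bar_Bb[OF y p(2)] h_fun_Bb[OF y'(2)] abs_Q_bar_le[OF y p(2)] abs_h_fun_le[OF y'(2)]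
          Q_bar_h_fun_diff[OF y \<eta>\<^sub>0 p(2)] K_lipschitz[OF y p(1) eta_Pr[OF y] E tv] tv])
qed

lemma cov_sum_C_fun_diff:
  assumes y: "y \<in> Env" and n: "1 \<le> n"
  shows "\<bar>(\<Sum>p\<in>{0..<n}. cov_term y n p) - (\<Sum>p\<in>{1..<n}. C_fun M G K \<eta>\<^sub>0 (env_shift (int p) y))\<bar> \<le>
    exp D * exp D * (1 + (8 * D + (5 * \<kappa> + 2) * a) / (1 - r))"
proof -
  define c1 where "c1 = 4 * exp D * (exp D * D)"
  define c2 where "c2 = (5 * \<kappa> + 2) * (exp D * exp D) * a"
  have D0: "0 \<le> D" using log_ratio_constant_nonneg[OF y] r by simp
  have "0 \<le> a * r ^ (0 - 0)"
    by (rule tv_le_nonneg[OF Phi_contraction[OF y le0 \<eta>\<^sub>0 \<eta>\<^sub>0]])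
  then have a0: "0 \<le> a" by simp
  have c: "0 \<le> c1" "0 \<le> c2" unfolding c1_def c2_def
    by (intro mult_nonneg_nonneg D0 a0 exp_ge_zero; use \<kappa> in simp)+
  have "\<bar>\<Sum>p\<in>{1..<n}. cov_term y n p - C_fun M G K \<eta>\<^sub>0 (env_shift (int p) y)\<bar>
      \<le> (\<Sum>p\<in>{1..<n}. c1 * r ^ p + c1 * r ^ (n - p) + c2 * r ^ (p - 1))"
  proof (rule order_trans[OF sum_abs sum_mono])
    fix p assume "p \<in> {1..<n}"
    then show "\<bar>cov_term y n p - C_fun M G K \<eta>\<^sub>0 (env_shift (int p) y)\<bar> \<le> c1 * r ^ p + c1 * r ^ (n - p) + c2 * r ^ (p - 1)"
      using cov_term_C_fun_diff[OF y, of p n] by (simp add: c1_def c2_def algebra_simps)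
  qed
  also have "\<dots> = c1 * (\<Sum>p\<in>{1..<n}. r ^ p) + c1 * (\<Sum>p\<in>{1..<n}. r ^ (n - p)) + c2 * (\<Sum>p\<in>{1..<n}. r ^ (p - 1))"
    by (simp add: sum.distrib sum_distrib_left)
  also have "\<dots> \<le> c1 * (1 / (1 - r)) + c1 * (1 / (1 - r)) + c2 * (1 / (1 - r))"
    using c by (intro add_mono mult_left_mono sum_power_inj_le r) (auto simp: inj_on_def)
  also have "\<dots> = exp D * exp D * ((8 * D + (5 * \<kappa> + 2) * a) / (1 - r))"
    by (simp add: c1_def c2_def add_divide_distrib algebra_simps)
  finally have 1: "\<bar>\<Sum>p\<in>{1..<n}. cov_term y n p - C_fun M G K \<eta>\<^sub>0 (env_shift (int p) y)\<bar>
    \<le> exp D * exp D * ((8 * D + (5 * \<kappa> + 2) * a) / (1 - r))" .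
  \<comment> \<open>The unmatched term p = 0 is at most exp D * exp D, which accounts for the 1 in
    the constant.\<close>
  have "(\<Sum>p\<in>{0..<n}. cov_term y n p) = cov_term y n 0 + (\<Sum>p\<in>{1..<n}. cov_term y n p)"
    using n by (simp add: sum.atLeast_Suc_lessThan)
  then have "(\<Sum>p\<in>{0..<n}. cov_term y n p) - (\<Sum>p\<in>{1..<n}. C_fun M G K \<eta>\<^sub>0 (env_shift (int p) y)) =
    cov_term y n 0 + (\<Sum>p\<in>{1..<n}. cov_term y n p - C_fun M G K \<eta>\<^sub>0 (env_shift (int p) y))"
    by (simp add: sum_subtractf)
  then show ?thesis using 1 cov_term_bounded[OF y le0, of n] by (simp add: distrib_left)
qed

end

section \<open>Averages along the environment\<close>

text \<open>On the law of the whole trajectory, stationarity says that the shift preserves the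
  measure, which is the setting of the ergodic theorem.\<close>

lemma ergodic_map_env_shift:
  assumes "prob_space P" and st: "stationary_process P S Y" and erg: "ergodic_process P S Y"
  shows "trajectory Y \<in> P \<rightarrow>\<^sub>M env_space S"
    and "ergodic_map (distr P (env_space S) (trajectory Y)) (env_shift 1)"
proof -
  interpret prob_space P by fact
  have Y: "Y n \<in> P \<rightarrow>\<^sub>M S" for n using st by (simp add: stationary_process_def)
  have "(\<lambda>\<omega> n. Y n \<omega>) \<in> P \<rightarrow>\<^sub>M env_space S"
    using measurable_space[OF Y] Y by (intro measurable_PiM_single') auto
  then show tr[measurable]: "trajectory Y \<in> P \<rightarrow>\<^sub>M env_space S" by (simp add: trajectory_def[abs_def])
  have "(\<lambda>y n. y (n + 1)) \<in> env_space S \<rightarrow>\<^sub>M env_space S"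
    by (intro measurable_PiM_single') (auto simp: space_PiM)
  then have sh[measurable]: "env_shift 1 \<in> env_space S \<rightarrow>\<^sub>M env_space S"
    by (simp add: env_shift_def[abs_def])
  show "ergodic_map (distr P (env_space S) (trajectory Y)) (env_shift 1)"
    unfolding ergodic_map_def
  proof (intro conjI ballI impI)
    show "prob_space (distr P (env_space S) (trajectory Y))" by (rule prob_space_distr[OF tr])
    show "distr (distr P (env_space S) (trajectory Y)) (distr P (env_space S) (trajectory Y)) (env_shift 1) =
        distr P (env_space S) (trajectory Y)"
      using st distr_distr[OF sh tr]
      by (simp add: stationary_process_def comp_def cong: distr_cong)
  qed (use erg in \<open>auto simp: ergodic_process_def\<close>)
qed

lemma env_shift_funpow: "(env_shift 1 ^^ k) y = env_shift (int k) y"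
  by (induction k) (simp_all add: env_shift_env_shift)

context fk_mckean
begin

lemma cov_average_C_fun_diff:
  "\<exists>c. \<forall>y\<in>Env. \<forall>n\<ge>1.
     \<bar>(1 / real n) * (\<Sum>p\<in>{0..<n}. cov_term y n p)
      - (1 / real n) * (\<Sum>p\<in>{1..<n}. C_fun M G K \<eta>\<^sub>0 (env_shift (int p) y))\<bar> \<le> c * (1 / real n)"
proof (intro exI ballI allI impI)
  fix y and n :: nat assume "y \<in> Env" "1 \<le> n"
  then show "\<bar>(1 / real n) * (\<Sum>p\<in>{0..<n}. cov_term y n p)
      - (1 / real n) * (\<Sum>p\<in>{1..<n}. C_fun M G K \<eta>\<^sub>0 (env_shift (int p) y))\<bar>
    \<le> exp D * exp D * (1 + (8 * D + (5 * \<kappa> + 2) * a) / (1 - r)) * (1 / real n)"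
    using divide_right_mono[OF cov_sum_C_fun_diff, of y n "real n"]
    by (simp add: right_diff_distrib[symmetric] abs_mult diff_divide_distrib[symmetric])
qed

text \<open>Birkhoff averages start at k = 0 and the comparison sum at p = 1; the extra term is one
  fixed number divided by n.\<close>

lemma cov_average_tendsto:
  assumes y: "y \<in> Env"
    and lim: "(\<lambda>n. (\<Sum>k<n. C_fun M G K \<eta>\<^sub>0 (env_shift (int k) y)) / real n) \<longlonglongrightarrow> L"
  shows "(\<lambda>n. (1 / real n) * (\<Sum>p\<in>{0..<n}. cov_term y n p)) \<longlonglongrightarrow> L"
proof -
  let ?A = "\<lambda>n. (1 / real n) * (\<Sum>p\<in>{0..<n}. cov_term y n p)"
    and ?C = "C_fun M G K \<eta>\<^sub>0"
  let ?B = "\<lambda>n. (1 / real n) * (\<Sum>p\<in>{1..<n}. ?C (env_shift (int p) y))"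
  obtain c where c: "\<And>n. 1 \<le> n \<Longrightarrow> \<bar>?A n - ?B n\<bar> \<le> c * (1 / real n)"
    using cov_average_C_fun_diff y by blast
  have "(\<lambda>n. ?A n - ?B n) \<longlonglongrightarrow> 0"
  proof (rule Lim_null_comparison)
    show "\<forall>\<^sub>F n in sequentially. norm (?A n - ?B n) \<le> c * (1 / real n)"
      using c by (intro eventually_sequentiallyI[of 1]) simp
    show "(\<lambda>n. c * (1 / real n)) \<longlonglongrightarrow> 0" by (intro tendsto_mult_right_zero lim_1_over_n)
  qed
  moreover have "?B \<longlonglongrightarrow> L - 0"
  proof (rule Lim_transform_eventually)
    show "(\<lambda>n. (\<Sum>k<n. ?C (env_shift (int k) y)) / real n - ?C y * (1 / real n)) \<longlonglongrightarrow> L - 0"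
      by (intro tendsto_diff lim tendsto_mult_right_zero lim_1_over_n)
    show "\<forall>\<^sub>F n in sequentially. (\<Sum>k<n. ?C (env_shift (int k) y)) / real n - ?C y * (1 / real n) = ?B n"
    proof (rule eventually_sequentiallyI[of 1])
      fix n :: nat assume "1 \<le> n"
      then have "(\<Sum>k<n. ?C (env_shift (int k) y)) = ?C y + (\<Sum>p\<in>{1..<n}. ?C (env_shift (int p) y))"
        by (simp add: lessThan_atLeast0 sum.atLeast_Suc_lessThan)
      then show "(\<Sum>k<n. ?C (env_shift (int k) y)) / real n - ?C y * (1 / real n) = ?B n"
        by (simp add: add_divide_distrib)
    qed
  qed
  ultimately show ?thesis using tendsto_add by fastforce
qed

lemma AE_cov_average_tendsto:
  assumes P: "prob_space P" "stationary_process P S Y" "ergodic_process P S Y"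
    and C[measurable]: "C_fun M G K \<eta>\<^sub>0 \<in> borel_measurable (env_space S)"
  shows "AE \<omega> in P. (\<lambda>n. (1 / real n) * (\<Sum>p\<in>{0..<n}. cov_term (trajectory Y \<omega>) n p))
    \<longlonglongrightarrow> (\<integral>\<omega>. C_fun M G K \<eta>\<^sub>0 (trajectory Y \<omega>) \<partial>P)"
proof -
  note tr = ergodic_map_env_shift(1)[OF P] and erg = ergodic_map_env_shift(2)[OF P]
  let ?N = "distr P (env_space S) (trajectory Y)" and ?C = "C_fun M G K \<eta>\<^sub>0"
  have "AE y in ?N. (\<lambda>n. (\<Sum>k<n. ?C ((env_shift 1 ^^ k) y)) / real n) \<longlonglongrightarrow> (\<integral>y. ?C y \<partial>?N)"
    by (rule birkhoff_bounded_ergodic[OF erg, of _ "exp D * exp D"]) (auto simp: C_fun_bounded)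
  from AE_distrD[OF tr this]
  have "AE \<omega> in P. (\<lambda>n. (\<Sum>k<n. ?C (env_shift (int k) (trajectory Y \<omega>))) / real n)
      \<longlonglongrightarrow> (\<integral>\<omega>. ?C (trajectory Y \<omega>) \<partial>P)"
    by (simp add: env_shift_funpow integral_distr[OF tr C])
  with AE_space show ?thesis
  proof eventually_elim
    case (elim \<omega>)
    then show ?case using cov_average_tendsto measurable_space[OF tr] by blast
  qed
qed

end

section \<open>From the standing assumptions to the working hypotheses\<close>

theorem corollary3p7:
  fixes P :: "'w measure"
    and S :: "'s measure"
    and Y :: "int \<Rightarrow> 'w \<Rightarrow> 's"
    and \<eta>\<^sub>0 :: "'e::polish_space measure"
    and M :: "'s \<Rightarrow> 'e \<Rightarrow> 'e measure"
    and G :: "'s \<Rightarrow> 'e \<Rightarrow> real"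
    and K :: "'s \<times> 's \<Rightarrow> 'e measure \<Rightarrow> 'e \<Rightarrow> 'e measure"
    and T :: "(int \<Rightarrow> 's) \<Rightarrow> nat \<Rightarrow> ('e \<Rightarrow> real) \<Rightarrow> 'e measure \<Rightarrow> 'e \<Rightarrow> real"
    and g a lam \<kappa> :: real
  assumes "prob_space P"
    and "stationary_process P S Y"
    and "ergodic_process P S Y"
    and "\<eta>\<^sub>0 \<in> space (prob_algebra borel)"
    and "\<And>s. s \<in> space S \<Longrightarrow> M s \<in> borel \<rightarrow>\<^sub>M prob_algebra borel"
    and "\<And>s. s \<in> space S \<Longrightarrow> G s \<in> borel_measurable borel"
    and "\<And>s x. s \<in> space S \<Longrightarrow> 0 < G s x"
    and "\<And>s. s \<in> space S \<Longrightarrow> bounded (range (G s))"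
    and "\<And>s s' \<mu>. s \<in> space S \<Longrightarrow> s' \<in> space S \<Longrightarrow> \<mu> \<in> space (prob_algebra borel) \<Longrightarrow>
           K (s, s') \<mu> \<in> borel \<rightarrow>\<^sub>M prob_algebra borel"
    and "\<And>s s' \<mu>. s \<in> space S \<Longrightarrow> s' \<in> space S \<Longrightarrow> \<mu> \<in> space (prob_algebra borel) \<Longrightarrow>
           Psi (G s) \<mu> \<bind> M s' = \<mu> \<bind> K (s, s') \<mu>"
    and "\<And>y n. y \<in> space (env_space S) \<Longrightarrow>
           0 < (INF x. G_at G y n x) \<and> (SUP x. G_at G y n x) / (INF x. G_at G y n x) \<le> g"
    and "0 < lam"
    and "\<And>y p n. y \<in> space (env_space S) \<Longrightarrow> p \<le> n \<Longrightarrow>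
           dobrushin (P_op M G y p n) \<le> ereal (a * exp (- lam * real (n - p)))"
    and "\<And>y n f \<mu>\<^sub>2. y \<in> space (env_space S) \<Longrightarrow> 1 \<le> n \<Longrightarrow> f \<in> Osc \<Longrightarrow>
           \<mu>\<^sub>2 \<in> space (prob_algebra borel) \<Longrightarrow> T y n f \<mu>\<^sub>2 \<in> Osc"
    and "\<And>y n f \<mu>\<^sub>1 \<mu>\<^sub>2. y \<in> space (env_space S) \<Longrightarrow> 1 \<le> n \<Longrightarrow> f \<in> Osc \<Longrightarrow>
           \<mu>\<^sub>1 \<in> space (prob_algebra borel) \<Longrightarrow> \<mu>\<^sub>2 \<in> space (prob_algebra borel) \<Longrightarrow>
           sup_norm (\<lambda>x. kernel_op (K_at K \<eta>\<^sub>0 y n \<mu>\<^sub>1) f x - kernel_op (K_at K \<eta>\<^sub>0 y n \<mu>\<^sub>2) f x)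
             \<le> ereal (\<kappa> * \<bar>(\<integral>x. T y n f \<mu>\<^sub>2 x \<partial>\<mu>\<^sub>1) - (\<integral>x. T y n f \<mu>\<^sub>2 x \<partial>\<mu>\<^sub>2)\<bar>)"
    and "C_fun M G K \<eta>\<^sub>0 \<in> borel_measurable (env_space S)"
  shows "(\<exists>c. \<forall>y\<in>space (env_space S). \<forall>n\<ge>1.
            \<bar>(1 / real n) * (\<Sum>p\<in>{0..<n}. Cov K \<eta>\<^sub>0 y p (eta M G \<eta>\<^sub>0 y (int p - 1))
                                (Q_bar M G \<eta>\<^sub>0 y p n (\<lambda>_. 1)) (Q_bar M G \<eta>\<^sub>0 y p n (\<lambda>_. 1)))
             - (1 / real n) * (\<Sum>p\<in>{1..<n}. C_fun M G K \<eta>\<^sub>0 (env_shift (int p) y))\<bar>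
            \<le> c * (1 / real n)) \<and>
         (AE \<omega> in P.
            (\<lambda>n. (1 / real n) * (\<Sum>p\<in>{0..<n}.
                    Cov K \<eta>\<^sub>0 (trajectory Y \<omega>) p (eta M G \<eta>\<^sub>0 (trajectory Y \<omega>) (int p - 1))
                      (Q_bar M G \<eta>\<^sub>0 (trajectory Y \<omega>) p n (\<lambda>_. 1))
                      (Q_bar M G \<eta>\<^sub>0 (trajectory Y \<omega>) p n (\<lambda>_. 1))))
            \<longlonglongrightarrow>
            (\<integral>\<omega>'. Cov K \<eta>\<^sub>0 (env_shift (- 1) (trajectory Y \<omega>')) 1
                     (eta_inf M G (env_shift (- 1) (trajectory Y \<omega>')))
                     (h_fun M G (trajectory Y \<omega>')) (h_fun M G (trajectory Y \<omega>')) \<partial>P))"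
proof -
  \<comment> \<open>Constant environments turn bounds along environments into bounds for a single
    state.\<close>
  have Env: "(\<lambda>_. s) \<in> space (env_space S)" if "s \<in> space S" for s
    using that by (auto simp: space_PiM)
  have lip: "\<bar>(\<integral>z. f z \<partial>K_at K \<eta>\<^sub>0 y n \<mu> x) - (\<integral>z. f z \<partial>K_at K \<eta>\<^sub>0 y n \<nu> x)\<bar> \<le> \<bar>\<kappa>\<bar> * d"
    if "y \<in> space (env_space S)" "1 \<le> n" "\<mu> \<in> Pr" "\<nu> \<in> Pr" "tv_le \<mu> \<nu> d" "f \<in> Osc" for y n \<mu> \<nu> d x f
  proof -
    let ?t = "\<bar>(\<integral>x. T y n f \<nu> x \<partial>\<mu>) - (\<integral>x. T y n f \<nu> x \<partial>\<nu>)\<bar>"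
    have "ereal \<bar>(\<integral>z. f z \<partial>K_at K \<eta>\<^sub>0 y n \<mu> x) - (\<integral>z. f z \<partial>K_at K \<eta>\<^sub>0 y n \<nu> x)\<bar> \<le>
        sup_norm (\<lambda>x. kernel_op (K_at K \<eta>\<^sub>0 y n \<mu>) f x - kernel_op (K_at K \<eta>\<^sub>0 y n \<nu>) f x)"
      unfolding sup_norm_def kernel_op_def by (rule SUP_upper) simp
    also have "\<dots> \<le> ereal (\<kappa> * ?t)"
      using that by (intro assms(15))
    finally have "\<bar>(\<integral>z. f z \<partial>K_at K \<eta>\<^sub>0 y n \<mu> x) - (\<integral>z. f z \<partial>K_at K \<eta>\<^sub>0 y n \<nu> x)\<bar> \<le> \<kappa> * ?t" by simp
    \<comment> \<open>The sign of \<kappa> is not assumed; its absolute value keeps the bound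
      monotone in d.\<close>
    also have "\<dots> \<le> \<bar>\<kappa>\<bar> * ?t" by (intro mult_right_mono) auto
    also have "\<dots> \<le> \<bar>\<kappa>\<bar> * d"
      using that by (intro mult_left_mono tv_leD[OF that(5)] assms(14)) auto
    finally show ?thesis .
  qed
  have bounds: "\<exists>m>0. \<forall>x. m \<le> G s x \<and> G s x \<le> g * m" if s: "s \<in> space S" for s
  \<comment> \<open>The witness is the infimum; boundedness of \<open>G s\<close> ensures that the
    real-valued \<open>INF\<close> and \<open>SUP\<close> are true bounds.\<close>
  proof (intro exI[of _ "INF x. G s x"] conjI allI)
    have G: "0 < (INF x. G s x)" "(SUP x. G s x) / (INF x. G s x) \<le> g"
      using assms(11)[OF Env[OF s], of 0] by (auto simp: G_at_def[abs_def])
    show "0 < (INF x. G s x)" by fact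
    show "(INF x. G s x) \<le> G s x" for x
      using assms(8)[OF s] by (intro cINF_lower bounded_imp_bdd_below) auto
    have "(SUP x. G s x) \<le> g * (INF x. G s x)" using G by (simp add: pos_divide_le_eq)
    moreover have "G s x \<le> (SUP x. G s x)" for x
      using assms(8)[OF s] by (intro cSUP_upper bounded_imp_bdd_above) auto
    ultimately show "G s x \<le> g * (INF x. G s x)" for x using order_trans by blast
  qed
  have "exp (- lam) ^ k = exp (- lam * real k)" for k
    by (simp add: exp_of_nat_mult[symmetric] mult.commute)
  then interpret fk_mckean S M G g a "exp (- lam)" K \<eta>\<^sub>0 "\<bar>\<kappa>\<bar>"
    using assms lip bounds by unfold_locales (auto simp: Bb_def tv_le_def)
  show ?thesis
    using cov_average_C_fun_diff AE_cov_average_tendsto[OF assms(1-3,16)]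
    unfolding C_fun_def by blast
qed

end
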